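(* Let $n,m,p\in\mathbb N$, $T>0$, $k\ge 3$, let $f\colon\mathbb R^n\to\mathbb R^n$, $h\colon\mathbb R^n\to\mathbb R^p$, $G\in\mathbb R^{n,m}$, $x_0\in\mathbb R^n$, let $\Gamma\in\mathbb R^{n,n}$, $R\in\mathbb R^{m,m}$, $Q\in\mathbb R^{p,p}$ be symmetric positive definite, let $y\colon[0,T]\to\mathbb R^p$ be the measured output, and let $\mathcal V\colon[0,T]\times\mathbb R^n\to\mathbb R$ be the associated minimum energy value function, which satisfies the Hamilton-Jacobi-Bellman equation given in the context. Assume: (A1) $f$ and $h$ are $k$-times continuously differentiable. (A2) For all $t\in[0,T]$ the function $\mathcal V(t,\cdot)$ is $(k+1)$-times continuously differentiable. (A3) $\mathcal V$ and its spatial derivatives are $C^1$ in time and the order of derivatives can be exchanged, i.e., for $\ell\le k$ it holds $\partial_t\mathbf D^{(\ell)}\mathcal V(\cdot,\widehat x_{\mathrm M}(\cdot))=\mathbf D^{(\ell)}\partial_t\mathcal V(\cdot,\widehat x_{\mathrm M}(\cdot))$. (B1) For every $t\in[0,T]$ the Mortensen observer $\widehat x_{\mathrm M}(t)=\operatorname{arg\,min}_{\xi\in\mathbb R^n}\mathcal V(t,\xi)$ is well-defined as the unique minimizer of $\mathcal V(t,\cdot)$. (B2) For all $t\in[0,T]$ the Hessian $\nabla^2\mathcal V(t,\widehat x_{\mathrm M}(t))$ is a regular (invertible) matrix. (C) $\mathbf D^{(k+1)}\mathcal V(t,\widehat x_{\mathrm M}(t))=0$ for all $t\in[0,T]$.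 Then $\widehat x_{\mathrm M}$ is characterized as the solution $\widehat x$ of the system below, i.e., there are functions $\mathbf P_j\colon[0,T]\to\bigotimes^j\mathbb R^n$, $j=2,\dots,k$, such that $\widehat x=\widehat x_{\mathrm M}$ together with $\mathbf P_2,\dots,\mathbf P_k$ satisfies $$\dot{\widehat x}(t)=f(\widehat x(t))+\mathbf P_2(t)^{-1}\mathcal J_h(\widehat x(t))^\top Q\,(y(t)-h(\widehat x(t))),$$ $$\begin{aligned}\dot{\mathbf P}_2(t)=&-\mathcal J_f(\widehat x(t))^\top\mathbf P_2(t)-\mathbf P_2(t)\mathcal J_f(\widehat x(t))-\mathbf P_2(t)GR^{-1}G^\top\mathbf P_2(t)-\mathbf R_2(t)\\&+\mathbf P_3(t)\underset{1,1}{*}\left(\mathbf P_2(t)^{-1}\left(\mathcal J_h(\widehat x(t))^\top Q(y(t)-h(\widehat x(t)))\right)\right),\end{aligned}$$ for $j=3,\dots,k-1$ $$\begin{aligned}\dot{\mathbf P}_j(t)=&-\sum_{i=1}^{j}\mathbf P_j(t)\times_i\left(\mathcal J_f(\widehat x(t))+GR^{-1}G^\top\mathbf P_2(t)\right)-\mathbf R_j(t)\\&+\mathbf P_{j+1}(t)\underset{1,1}{*}\left(\mathbf P_2(t)^{-1}\left(\mathcal J_h(\widehat x(t))^\top Q(y(t)-h(\widehat x(t)))\right)\right),\end{aligned}$$ and $$\dot{\mathbf P}_k(t)=-\sum_{i=1}^{k}\mathbf P_k(t)\times_i\left(\mathcal J_f(\widehat x(t))+GR^{-1}G^\top\mathbf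 P_2(t)\right)-\mathbf R_k(t),$$ with the initial conditions $\widehat x(0)=x_0$, $\mathbf P_2(0)=\Gamma$, and $\mathbf P_j(0)=0$ for all $j=3,\dots,k$, where for $\ell=2,\dots,k$ $$\begin{aligned}\mathbf R_\ell(t)=&\sum_{i=1}^{\ell-2}\operatorname{sym}_{i,\ell-i}\left(\mathbf P_{i+1}(t)\underset{1,1}{*}\mathbf D^{(\ell-i)}f(\widehat x(t))\right)\\&+\frac12\sum_{i=2}^{\ell-2}\operatorname{sym}_{i,\ell-i}\left(\mathbf P_{i+1}(t)\underset{1,1}{*}\left(GR^{-1}G^\top\underset{2,1}{*}\mathbf P_{\ell-i+1}(t)\right)\right)\\&+\mathbf D^{(\ell)}h(\widehat x(t))\underset{1,1}{*}Q\,(y(t)-h(\widehat x(t)))\\&-\frac12\sum_{i=1}^{\ell-1}\operatorname{sym}_{i,\ell-i}\left(\mathbf D^{(i)}h(\widehat x(t))\underset{1,1}{*}\left(Q\underset{2,1}{*}\mathbf D^{(\ell-i)}h(\widehat x(t))\right)\right).\end{aligned}$$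
   Context: **System and value function.** The output $y(t)=h(x(t))+\mu(t)$ is a given measurement of the disturbed system $\dot x=f(x)+Gv$, $x(0)=x_0+\eta$, on $[0,T]$ with unknown disturbances $v\in L^2(0,T;\mathbb R^m)$, $\eta\in\mathbb R^n$, $\mu\in L^2(0,T;\mathbb R^p)$. For symmetric positive definite $M$ write $\|z\|_M^2=z^\top Mz$. The value function is $$\mathcal V(t,\xi)=\min_{v\in L^2(0,t;\mathbb R^m)}\ \tfrac12\|x(0)-x_0\|_\Gamma^2+\tfrac12\int_0^t\|v(s)\|_R^2+\|y(s)-h(x(s))\|_Q^2\,\mathrm ds$$ subject to $\dot x(s)=f(x(s))+Gv(s)$ for $s\in(0,t)$, $x(t)=\xi$. It is taken to satisfy the Hamilton-Jacobi-Bellman equation $$\partial_t\mathcal V(t,\xi)=-\nabla\mathcal V(t,\xi)^\top f(\xi)-\tfrac12\|G^\top\nabla\mathcal V(t,\xi)\|_{R^{-1}}^2+\tfrac12\|y(t)-h(\xi)\|_Q^2,\qquad \mathcal V(0,\xi)=\tfrac12\|\xi-x_0\|_\Gamma^2,$$ where $\nabla$, $\nabla^2$ denote spatial gradient and Hessian. $\mathcal J_f,\mathcal J_h$ denote Jacobians. **Tensors.** $\mathbb R^{n_1,\dots,n_d}$ is the set of real arrays $\mathbf T[i_1,\dots,i_d]$, $1\le i_\mu\le n_\mu$ (order $d$); vectors and matrices are tensors of order 1 and 2; $\bigotimes^d\mathbb R^n=\mathbb R^{n,\dots,n}$ ($d$ times). For $\mathbf A$ of order $d$ and $\mathbf B$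 of order $\ell$ with equal $\mu$-th and $\nu$-th dimension $N$, the contraction is $$(\mathbf A\underset{\mu,\nu}{*}\mathbf B)[i_1,\dots,i_{\mu-1},i_{\mu+1},\dots,i_d,j_1,\dots,j_{\nu-1},j_{\nu+1},\dots,j_\ell]=\sum_{r=1}^{N}\mathbf A[i_1,\dots,i_{\mu-1},r,i_{\mu+1},\dots,i_d]\,\mathbf B[j_1,\dots,j_{\nu-1},r,j_{\nu+1},\dots,j_\ell].$$ For a matrix $\mathbf C$, $(\mathbf A\times_\mu\mathbf C)[i_1,\dots,i_d]=\sum_r\mathbf A[i_1,\dots,i_{\mu-1},r,i_{\mu+1},\dots,i_d]\,\mathbf C[r,i_\mu]$. For $\sigma\in S_d$, $\mathbf A^\sigma[i_1,\dots,i_d]=\mathbf A[i_{\sigma(1)},\dots,i_{\sigma(d)}]$. Let $S_{i,j}=\{\sigma\in S_{i+j}:\sigma(1)<\dots<\sigma(i)\text{ and }\sigma(i+1)<\dots<\sigma(i+j)\}$, and for $\mathbf T\in\bigotimes^{i+j}\mathbb R^n$ let $\operatorname{sym}_{i,j}(\mathbf T)=\sum_{\sigma\in S_{i,j}}\mathbf T^\sigma$ (no normalizing factor). **Derivatives as tensors.** For scalar $u$: $\mathbf D^{(k)}u(\xi)[j_1,\dots,j_k]=\partial_{j_k,\dots,j_1}u(\xi)$. For vector-valued $g$: $\mathbf D^{(k)}g(\xi)[i,j_1,\dots,j_k]=\partial_{j_k,\dots,j_1}g_i(\xi)$. $\mathbf D^{(\ell)}\mathcal V$ is taken with respect to the spatial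 variable. Empty sums are zero.
   Formalization: The formal theorem also assumes that the Mortensen observer is continuous on [0,T] (otherwise the unique minimizer may jump from infinity and the claim fails), and reads "C^1 in time" in (A3) as: the time derivatives are jointly continuous in (t, ξ). *)

theory Defs
  imports "HOL-Analysis.Analysis"
begin

section \<open>Minimum energy estimation\<close>

definition spd :: "real^'a^'a \<Rightarrow> bool" where
  "spd M \<longleftrightarrow> transpose M = M \<and> (\<forall>z. z \<noteq> 0 \<longrightarrow> z \<bullet> (M *v z) > 0)"

definition sqnorm :: "real^'a^'a \<Rightarrow> real^'a \<Rightarrow> real" where
  "sqnorm M z = z \<bullet> (M *v z)"

definition L2_on :: "real \<Rightarrow> (real \<Rightarrow> real^'a) \<Rightarrow> bool" where
  "L2_on t v \<longleftrightarrow> v \<in> borel_measurable (lebesgue_on {0..t}) \<and>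
     integrable (lebesgue_on {0..t}) (\<lambda>s. (norm (v s))\<^sup>2)"

text \<open>Since \<open>v\<close> is merely square integrable, the differential equation is understood in the
  sense of Caratheodory, i.e. in integrated form.\<close>

definition solves_state_eq ::
    "(real^'n \<Rightarrow> real^'n) \<Rightarrow> real^'m^'n \<Rightarrow> real \<Rightarrow> (real \<Rightarrow> real^'m) \<Rightarrow> (real \<Rightarrow> real^'n) \<Rightarrow> bool" where
  "solves_state_eq f G t v x \<longleftrightarrow>
     (\<forall>s\<in>{0..t}. ((\<lambda>r. f (x r) + G *v v r) has_integral (x s - x 0)) {0..s})"

definition measured_output ::
    "(real^'n \<Rightarrow> real^'n) \<Rightarrow> (real^'n \<Rightarrow> real^'p) \<Rightarrow> real^'m^'n \<Rightarrow> real^'n \<Rightarrow> real \<Rightarrow>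
      (real \<Rightarrow> real^'p) \<Rightarrow> bool" where
  "measured_output f h G x0 T y \<longleftrightarrow>
     (\<exists>v \<eta> \<mu> x. L2_on T v \<and> L2_on T \<mu> \<and> solves_state_eq f G T v x \<and> x 0 = x0 + \<eta> \<and>
        (\<forall>t\<in>{0..T}. y t = h (x t) + \<mu> t))"

definition energy ::
    "(real^'n \<Rightarrow> real^'p) \<Rightarrow> real^'n \<Rightarrow> real^'n^'n \<Rightarrow> real^'m^'m \<Rightarrow> real^'p^'p \<Rightarrow>
      (real \<Rightarrow> real^'p) \<Rightarrow> real \<Rightarrow> (real \<Rightarrow> real^'m) \<Rightarrow> (real \<Rightarrow> real^'n) \<Rightarrow> real" where
  "energy h x0 \<Gamma> R Q y t v x =
     1/2 * sqnorm \<Gamma> (x 0 - x0) +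
     1/2 * integral {0..t} (\<lambda>s. sqnorm R (v s) + sqnorm Q (y s - h (x s)))"

definition admissible ::
    "(real^'n \<Rightarrow> real^'n) \<Rightarrow> real^'m^'n \<Rightarrow> real \<Rightarrow> real^'n \<Rightarrow>
      (real \<Rightarrow> real^'m) \<Rightarrow> (real \<Rightarrow> real^'n) \<Rightarrow> bool" where
  "admissible f G t \<xi> v x \<longleftrightarrow> L2_on t v \<and> solves_state_eq f G t v x \<and> x t = \<xi>"

definition value_function ::
    "(real^'n \<Rightarrow> real^'n) \<Rightarrow> (real^'n \<Rightarrow> real^'p) \<Rightarrow> real^'m^'n \<Rightarrow> real^'n \<Rightarrow>
      real^'n^'n \<Rightarrow> real^'m^'m \<Rightarrow> real^'p^'p \<Rightarrow> (real \<Rightarrow> real^'p) \<Rightarrow> real \<Rightarrow>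
      (real \<Rightarrow> real^'n \<Rightarrow> real) \<Rightarrow> bool" where
  "value_function f h G x0 \<Gamma> R Q y T V \<longleftrightarrow>
     (\<forall>t\<in>{0..T}. \<forall>\<xi>.
        (\<exists>v x. admissible f G t \<xi> v x \<and> energy h x0 \<Gamma> R Q y t v x = V t \<xi>) \<and>
        (\<forall>v x. admissible f G t \<xi> v x \<longrightarrow> V t \<xi> \<le> energy h x0 \<Gamma> R Q y t v x))"

definition mortensen_observer :: "(real \<Rightarrow> real^'n \<Rightarrow> real) \<Rightarrow> real \<Rightarrow> real^'n" where
  "mortensen_observer V t = (ARG_MIN (V t) \<xi>. True)"

section \<open>Derivatives as tensors\<close>

text \<open>An element of the $d$-fold tensor power of $\mathbb{R}^n$ is represented by a function on
  index lists, of which only the values on lists of length \<open>d\<close> matter. Tensors whose first mode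
  has a different dimension (derivatives of vector-valued maps) are functions
  \<open>'r \<Rightarrow> 'n list \<Rightarrow> real\<close>, the first mode being the first argument.\<close>

type_synonym 'n tensor = "'n list \<Rightarrow> real"

definition partial :: "'n::finite \<Rightarrow> (real^'n \<Rightarrow> real) \<Rightarrow> real^'n \<Rightarrow> real" where
  "partial j u \<xi> = deriv (\<lambda>s. u (\<xi> + s *\<^sub>R axis j 1)) 0"

text \<open>\<open>Dt u \<xi> [j\<^sub>1,\<dots>,j\<^sub>k]\<close> is the entry of \<open>D\<^sup>(\<^sup>k\<^sup>) u(\<xi>)\<close>; the derivative
  in direction \<open>j\<^sub>1\<close> is taken first.\<close>

primrec iter_partial :: "'n::finite list \<Rightarrow> (real^'n \<Rightarrow> real) \<Rightarrow> real^'n \<Rightarrow> real" where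
  "iter_partial [] u = u"
| "iter_partial (j # js) u = iter_partial js (partial j u)"

definition Dt :: "(real^'n \<Rightarrow> real) \<Rightarrow> real^'n \<Rightarrow> 'n::finite tensor" where
  "Dt u \<xi> js = iter_partial js u \<xi>"

definition Dvec :: "(real^'n \<Rightarrow> real^'p) \<Rightarrow> real^'n \<Rightarrow> 'p \<Rightarrow> 'n::finite tensor" where
  "Dvec g \<xi> i = Dt (\<lambda>\<zeta>. g \<zeta> $ i) \<xi>"

primrec Ck :: "nat \<Rightarrow> (real^'n::finite \<Rightarrow> real) \<Rightarrow> bool" where
  "Ck 0 u \<longleftrightarrow> continuous_on UNIV u"
| "Ck (Suc k) u \<longleftrightarrow> (\<forall>\<xi>. u differentiable (at \<xi>)) \<and> (\<forall>j. Ck k (partial j u))"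

definition Ck_vec :: "nat \<Rightarrow> (real^'n::finite \<Rightarrow> real^'p) \<Rightarrow> bool" where
  "Ck_vec k g \<longleftrightarrow> (\<forall>i. Ck k (\<lambda>\<xi>. g \<xi> $ i))"

definition tensor_matrix :: "'n tensor \<Rightarrow> real^'n::finite^'n" where
  "tensor_matrix A = (\<chi> i j. A [i, j])"

definition gradient :: "(real^'n \<Rightarrow> real) \<Rightarrow> real^'n \<Rightarrow> real^'n::finite" where
  "gradient u \<xi> = (\<chi> i. Dt u \<xi> [i])"

definition hessian :: "(real^'n \<Rightarrow> real) \<Rightarrow> real^'n \<Rightarrow> real^'n::finite^'n" where
  "hessian u \<xi> = tensor_matrix (Dt u \<xi>)"

text \<open>The time derivative on \<open>[0,T]\<close>, one-sided at the end points.\<close>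

definition time_deriv :: "real \<Rightarrow> (real \<Rightarrow> real) \<Rightarrow> real \<Rightarrow> real" where
  "time_deriv T u t = vector_derivative u (at t within {0..T})"

definition HJB ::
    "(real^'n \<Rightarrow> real^'n) \<Rightarrow> (real^'n \<Rightarrow> real^'p) \<Rightarrow> real^'m^'n \<Rightarrow> real^'n \<Rightarrow>
      real^'n^'n \<Rightarrow> real^'m^'m \<Rightarrow> real^'p^'p \<Rightarrow> (real \<Rightarrow> real^'p) \<Rightarrow> real \<Rightarrow>
      (real \<Rightarrow> real^'n::finite \<Rightarrow> real) \<Rightarrow> bool" where
  "HJB f h G x0 \<Gamma> R Q y T V \<longleftrightarrow>
     (\<forall>t\<in>{0..T}. \<forall>\<xi>. ((\<lambda>s. V s \<xi>) has_real_derivative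
         (- (gradient (V t) \<xi> \<bullet> f \<xi>)
          - 1/2 * sqnorm (matrix_inv R) (transpose G *v gradient (V t) \<xi>)
          + 1/2 * sqnorm Q (y t - h \<xi>))) (at t within {0..T})) \<and>
     (\<forall>\<xi>. V 0 \<xi> = 1/2 * sqnorm \<Gamma> (\<xi> - x0))"

section \<open>Tensor operations\<close>

text \<open>Positions in index lists are counted from 0.\<close>

definition first_mode :: "'n tensor \<Rightarrow> 'n \<Rightarrow> 'n tensor" where
  "first_mode A r is = A (r # is)"

text \<open>The contraction of the first modes, where \<open>i\<close> is the order of \<open>A\<close> minus one, so that the first
  \<open>i\<close> indices of the result belong to \<open>A\<close> and the remaining ones to \<open>B\<close>.\<close>

definition contract11 :: "nat \<Rightarrow> ('r::finite \<Rightarrow> 'n tensor) \<Rightarrow> ('r \<Rightarrow> 'n tensor) \<Rightarrow> 'n tensor" where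
  "contract11 i A B is = (\<Sum>r\<in>UNIV. A r (take i is) * B r (drop i is))"

definition vec_tensor :: "real^'r \<Rightarrow> 'r \<Rightarrow> 'n tensor" where
  "vec_tensor w r is = w $ r"

text \<open>The contraction of the second mode of a matrix with the first mode of a tensor.\<close>

definition contract21 :: "real^'s::finite^'r \<Rightarrow> ('s \<Rightarrow> 'n tensor) \<Rightarrow> 'r \<Rightarrow> 'n tensor" where
  "contract21 C B r is = (\<Sum>s\<in>UNIV. C $ r $ s * B s is)"

definition mode_product :: "'n tensor \<Rightarrow> nat \<Rightarrow> real^'n::finite^'n \<Rightarrow> 'n tensor" where
  "mode_product A \<mu> C is = (\<Sum>r\<in>UNIV. A (is[\<mu> := r]) * C $ r $ (is ! \<mu>))"

definition shuffle_perms :: "nat \<Rightarrow> nat \<Rightarrow> (nat \<Rightarrow> nat) set" where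
  "shuffle_perms i j = {\<sigma>. \<sigma> permutes {..<i+j} \<and>
     strict_mono_on {..<i} \<sigma> \<and> strict_mono_on {i..<i+j} \<sigma>}"

definition sym_shuffle :: "nat \<Rightarrow> nat \<Rightarrow> 'n tensor \<Rightarrow> 'n tensor" where
  "sym_shuffle i j A is = (\<Sum>\<sigma>\<in>shuffle_perms i j. A (permute_list \<sigma> is))"

section \<open>The observer system\<close>

text \<open>Here \<open>\<xi>\<close>, \<open>\<upsilon>\<close> and \<open>P j\<close> stand for the values of the observer trajectory, of the output and
  of the order-\<open>j\<close> tensor at a fixed time.\<close>

definition gain ::
    "(real^'n \<Rightarrow> real^'p) \<Rightarrow> real^'p^'p \<Rightarrow> real^'p \<Rightarrow> real^'n \<Rightarrow> (nat \<Rightarrow> 'n tensor) \<Rightarrow>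
      real^'n::finite" where
  "gain h Q \<upsilon> \<xi> P =
     matrix_inv (tensor_matrix (P 2)) *v (transpose (jacobian h (at \<xi>)) *v (Q *v (\<upsilon> - h \<xi>)))"

definition Rtensor ::
    "(real^'n \<Rightarrow> real^'n) \<Rightarrow> (real^'n \<Rightarrow> real^'p) \<Rightarrow> real^'m^'n \<Rightarrow> real^'m^'m \<Rightarrow> real^'p^'p \<Rightarrow>
      real^'p \<Rightarrow> real^'n \<Rightarrow> (nat \<Rightarrow> 'n tensor) \<Rightarrow> nat \<Rightarrow> 'n::finite tensor" where
  "Rtensor f h G R Q \<upsilon> \<xi> P l is =
     (\<Sum>i=1..l-2. sym_shuffle i (l-i) (contract11 i (first_mode (P (i+1))) (Dvec f \<xi>)) is)
     + 1/2 * (\<Sum>i=2..l-2. sym_shuffle i (l-i)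
         (contract11 i (first_mode (P (i+1)))
            (contract21 (G ** matrix_inv R ** transpose G) (first_mode (P (l-i+1))))) is)
     + contract11 l (Dvec h \<xi>) (vec_tensor (Q *v (\<upsilon> - h \<xi>))) is
     - 1/2 * (\<Sum>i=1..l-1. sym_shuffle i (l-i) (contract11 i (Dvec h \<xi>) (contract21 Q (Dvec h \<xi>))) is)"

definition observer_system ::
    "(real^'n \<Rightarrow> real^'n) \<Rightarrow> (real^'n \<Rightarrow> real^'p) \<Rightarrow> real^'m^'n \<Rightarrow> real^'n \<Rightarrow>
      real^'n^'n \<Rightarrow> real^'m^'m \<Rightarrow> real^'p^'p \<Rightarrow> (real \<Rightarrow> real^'p) \<Rightarrow> real \<Rightarrow> nat \<Rightarrow>
      (real \<Rightarrow> real^'n) \<Rightarrow> (nat \<Rightarrow> real \<Rightarrow> 'n::finite tensor) \<Rightarrow> bool" where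
  "observer_system f h G x0 \<Gamma> R Q y T k x P \<longleftrightarrow>
     (\<forall>t\<in>{0..T}.
        let P2 = tensor_matrix (P 2 t);
            W = G ** matrix_inv R ** transpose G;
            J = jacobian f (at (x t));
            w = gain h Q (y t) (x t) (\<lambda>j. P j t);
            Rt = Rtensor f h G R Q (y t) (x t) (\<lambda>j. P j t)
        in
          invertible P2 \<and>
          (x has_vector_derivative (f (x t) + w)) (at t within {0..T}) \<and>
          ((\<lambda>s. tensor_matrix (P 2 s)) has_vector_derivative
             (- (transpose J ** P2) - P2 ** J - P2 ** W ** P2 - tensor_matrix (Rt 2)
              + tensor_matrix (contract11 2 (first_mode (P 3 t)) (vec_tensor w))))
             (at t within {0..T}) \<and>
          (\<forall>j\<in>{3..k-1}. \<forall>is. length is = j \<longrightarrow>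
             ((\<lambda>s. P j s is) has_real_derivative
                (- (\<Sum>i<j. mode_product (P j t) i (J + W ** P2) is) - Rt j is
                 + contract11 j (first_mode (P (j+1) t)) (vec_tensor w) is))
             (at t within {0..T})) \<and>
          (\<forall>is. length is = k \<longrightarrow>
             ((\<lambda>s. P k s is) has_real_derivative
                (- (\<Sum>i<k. mode_product (P k t) i (J + W ** P2) is) - Rt k is))
             (at t within {0..T}))) \<and>
     x 0 = x0 \<and> tensor_matrix (P 2 0) = \<Gamma> \<and>
     (\<forall>j\<in>{3..k}. \<forall>is. length is = j \<longrightarrow> P j 0 is = 0)"

end

theory Submission
  imports Defs
begin

text \<open>The tensors are \<open>P\<^sub>j(t) = D\<^sup>(\<^sup>j\<^sup>)V(t, x(t))\<close>, where \<open>x\<close> is the Mortensen observer. With this choice every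
equation of the observer system says how a spatial derivative of the value function changes along
\<open>x\<close>. Two facts are combined.

The first is the total derivative in time (\<open>total_time_derivative\<close>):
\[ \frac{d}{dt}\, D^{(l)}V(t,x(t)) = (\partial_t D^{(l)}V)(t,x(t))
     + \sum_j D^{(l+1)}V(t,x(t))[j,\cdot]\;\dot x_j(t). \]
For \<open>l = 1\<close> the left-hand side is zero, because \<open>x(t)\<close> is a critical point. Since the Hessian is
invertible, the equation can be solved for the velocity; the observer is only known to be
continuous, and its differentiability comes out of the same argument
(\<open>has_vector_derivative_cancel_left\<close>).

The second is that the time derivative may be exchanged with the spatial ones, so that
\<open>\<partial>\<^sub>tD\<^sup>(\<^sup>l\<^sup>)V\<close> is the \<open>l\<close>-th derivative tensor of the right-hand side of the
Hamilton-Jacobi-Bellman equation. That right-hand side consists of sums of products, and by the Leibniz rule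
(\<open>Dt_sum_mult\<close>) the \<open>l\<close>-th derivative of a sum of products is the sum over \<open>i \<le> l\<close> of the shuffle
symmetrizations of contracted derivatives. As the gradient vanishes at \<open>x(t)\<close>, every factor of
order zero coming from the gradient disappears. What remains for \<open>l \<ge> 2\<close>
(\<open>Dt_HJB_rhs_order_ge_2\<close>) is:

  \<^item> in the transport term \<open>\<nabla>V \<cdot> f\<close> the summand \<open>i = l\<close>, which contains \<open>P\<^sub>l\<^sub>+\<^sub>1\<close> contracted with \<open>f\<close>
    and cancels the part \<open>f\<close> of the velocity, so that only the correction term of the observer is
    contracted with \<open>P\<^sub>l\<^sub>+\<^sub>1\<close>; the summand \<open>i = l - 1\<close>, which is the sum of mode products with the
    Jacobian of \<open>f\<close>; and lower ones, which belong to \<open>R\<^sub>l\<close>;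

  \<^item> in the term quadratic in the gradient the summands \<open>i = 1\<close> and \<open>i = l - 1\<close>, which both equal the
    sum of mode products with \<open>G R\<^sup>-\<^sup>1 G\<^sup>T P\<^sub>2\<close> and are merged by the factor one half (for \<open>l = 2\<close> they
    are one and the same summand, which explains the different shape of the equation for \<open>P\<^sub>2\<close>);
    and the middle ones, which belong to \<open>R\<^sub>l\<close>;

  \<^item> the output term, all of which belongs to \<open>R\<^sub>l\<close>.

Turning a shuffle sum into mode products moves an index from the front to another
position and therefore needs the symmetry of higher derivatives (\<open>Dt_mset\<close>). The equation of
order \<open>k\<close> is closed since \<open>P\<^sub>k\<^sub>+\<^sub>1\<close> is zero by hypothesis, and the initial values are the derivatives
of a quadratic form at its centre.\<close>

section \<open>Partial derivatives of functions of class C^k\<close>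

lemma partial_has_derivative:
  assumes "(u has_derivative u') (at \<xi>)"
  shows "partial j u \<xi> = u' (axis j 1)"
proof -
  have l: "((\<lambda>s. \<xi> + s *\<^sub>R axis j (1::real)) has_derivative (\<lambda>s. s *\<^sub>R axis j 1)) (at 0)"
    by (auto intro!: derivative_eq_intros)
  have "((\<lambda>s. u (\<xi> + s *\<^sub>R axis j 1)) has_derivative (\<lambda>s. u' (s *\<^sub>R axis j 1))) (at 0)"
    using has_derivative_compose[OF l, of u u'] assms by simp
  moreover have "(\<lambda>s. u' (s *\<^sub>R axis j 1)) = (*) (u' (axis j 1))"
    using has_derivative_bounded_linear[OF assms, THEN bounded_linear.linear, THEN linear_scale]
    by (auto simp: mult.commute)
  ultimately have "((\<lambda>s. u (\<xi> + s *\<^sub>R axis j 1)) has_field_derivative u' (axis j 1)) (at 0)"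
    by (simp add: has_field_derivative_def)
  then show ?thesis
    unfolding partial_def by (rule DERIV_imp_deriv)
qed

text \<open>Evaluating the Frechet derivative at the basis vectors identifies it with the partial derivatives;
the regularity class is defined through the latter, while the chain rule needs the former.\<close>

lemma has_derivative_partials:
  fixes u :: "real^'n \<Rightarrow> real"
  assumes "u differentiable (at \<xi>)"
  shows "(u has_derivative (\<lambda>v. \<Sum>j\<in>UNIV. partial j u \<xi> * v $ j)) (at \<xi>)"
proof -
  from assms obtain u' where u': "(u has_derivative u') (at \<xi>)"
    by (auto simp: differentiable_def)
  interpret linear u'
    using u' by (rule has_derivative_linear)
  have "u' v = (\<Sum>j\<in>UNIV. partial j u \<xi> * v $ j)" for v
  proof -
    have "u' v = u' (\<Sum>j\<in>UNIV. v $ j *\<^sub>R axis j 1)"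
      by (simp add: basis_expansion flip: scalar_mult_eq_scaleR)
    also have "\<dots> = (\<Sum>j\<in>UNIV. partial j u \<xi> * v $ j)"
      by (simp add: sum scale partial_has_derivative[OF u'] mult.commute)
    finally show ?thesis .
  qed
  then have "u' = (\<lambda>v. \<Sum>j\<in>UNIV. partial j u \<xi> * v $ j)" by blast
  with u' show ?thesis by simp
qed

lemma partial_add:
  assumes "u differentiable (at \<xi>)" "v differentiable (at \<xi>)"
  shows "partial j (\<lambda>\<zeta>. u \<zeta> + v \<zeta>) \<xi> = partial j u \<xi> + partial j v \<xi>"
proof -
  from assms obtain u' v' where
    "(u has_derivative u') (at \<xi>)" "(v has_derivative v') (at \<xi>)"
    by (auto simp: differentiable_def)
  then show ?thesis
    using partial_has_derivative[OF has_derivative_add, of u u' \<xi> v v' j]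
    by (simp add: partial_has_derivative)
qed

lemma partial_mult:
  fixes u v :: "real^'n \<Rightarrow> real"
  assumes "u differentiable (at \<xi>)" "v differentiable (at \<xi>)"
  shows "partial j (\<lambda>\<zeta>. u \<zeta> * v \<zeta>) \<xi> = partial j u \<xi> * v \<xi> + u \<xi> * partial j v \<xi>"
proof -
  from assms obtain u' v' where
    "(u has_derivative u') (at \<xi>)" "(v has_derivative v') (at \<xi>)"
    by (auto simp: differentiable_def)
  then show ?thesis
    using partial_has_derivative[OF has_derivative_mult, of u u' \<xi> v v' j]
    by (simp add: partial_has_derivative)
qed

lemma partial_const [simp]: "partial j (\<lambda>_. c) = (\<lambda>_. 0)"
  by (auto simp: partial_def)

lemma Ck_imp_continuous: "Ck k u \<Longrightarrow> continuous_on UNIV u"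
  by (cases k)
    (auto intro!: continuous_at_imp_continuous_on differentiable_imp_continuous_within)

lemma Ck_SucD: "Ck (Suc k) u \<Longrightarrow> Ck k u"
proof (induction k arbitrary: u)
  case 0
  then show ?case using Ck_imp_continuous[of "Suc 0" u] by simp
next
  case (Suc k)
  show ?case
    using Suc.IH Suc.prems unfolding Ck.simps(2)[of "Suc k" u] Ck.simps(2)[of k u] by blast
qed

lemma Ck_mono: "Ck k u \<Longrightarrow> l \<le> k \<Longrightarrow> Ck l u"
  by (induction k) (auto simp del: Ck.simps elim!: le_SucE dest: Ck_SucD)

lemma Ck_iter_partial: "Ck k u \<Longrightarrow> length is \<le> k \<Longrightarrow> Ck (k - length is) (iter_partial is u)"
proof (induction "is" arbitrary: u k)
  case (Cons j js)
  then obtain k' where "k = Suc k'" by (cases k) auto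
  with Cons show ?case by simp
qed simp

lemma Ck_iter_partialI: "Ck k u \<Longrightarrow> l + length is \<le> k \<Longrightarrow> Ck l (iter_partial is u)"
  by (rule Ck_mono[OF Ck_iter_partial]) auto

lemma Ck_differentiable: "Ck k u \<Longrightarrow> 1 \<le> k \<Longrightarrow> u differentiable (at \<xi>)"
  by (cases k) auto

lemma Ck_const [simp]: "Ck k (\<lambda>_. c)"
  by (induction k arbitrary: c) auto

lemma Ck_add: "Ck k u \<Longrightarrow> Ck k v \<Longrightarrow> Ck k (\<lambda>\<xi>. u \<xi> + v \<xi>)"
proof (induction k arbitrary: u v)
  case 0
  then show ?case by (auto intro: continuous_intros)
next
  case (Suc k)
  have "partial j (\<lambda>\<xi>. u \<xi> + v \<xi>) = (\<lambda>\<xi>. partial j u \<xi> + partial j v \<xi>)" for j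
    using Suc.prems by (auto simp: partial_add)
  then show ?case using Suc by (auto intro!: differentiable_add)
qed

lemma Ck_mult: "Ck k u \<Longrightarrow> Ck k v \<Longrightarrow> Ck k (\<lambda>\<xi>. u \<xi> * v \<xi>)"
proof (induction k arbitrary: u v)
  case 0
  then show ?case by (auto intro: continuous_intros)
next
  case (Suc k)
  have "partial j (\<lambda>\<xi>. u \<xi> * v \<xi>) = (\<lambda>\<xi>. partial j u \<xi> * v \<xi> + u \<xi> * partial j v \<xi>)" for j
    using Suc.prems by (auto simp: partial_mult)
  moreover have "Ck k (partial j u)" "Ck k u" "Ck k v" "Ck k (partial j v)" for j
    using Suc.prems Ck_SucD by auto
  ultimately show ?case using Suc.prems
    by (auto intro!: Ck_add Suc.IH differentiable_mult)
qed

lemma Ck_sum: "finite I \<Longrightarrow> (\<And>i. i \<in> I \<Longrightarrow> Ck k (u i)) \<Longrightarrow> Ck k (\<lambda>\<xi>. \<Sum>i\<in>I. u i \<xi>)"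
  by (induction I rule: finite_induct) (auto intro!: Ck_add)

lemma iter_partial_const: "iter_partial is (\<lambda>_. c) \<xi> = (if is = [] then c else 0)"
  by (induction "is" arbitrary: c) auto

lemma iter_partial_add:
  "Ck (length is) u \<Longrightarrow> Ck (length is) v \<Longrightarrow>
    iter_partial is (\<lambda>\<xi>. u \<xi> + v \<xi>) \<xi> = iter_partial is u \<xi> + iter_partial is v \<xi>"
proof (induction "is" arbitrary: u v)
  case (Cons j js)
  have "partial j (\<lambda>\<xi>. u \<xi> + v \<xi>) = (\<lambda>\<xi>. partial j u \<xi> + partial j v \<xi>)"
    using Cons.prems by (auto simp: partial_add)
  then show ?case using Cons by simp
qed simp

lemma iter_partial_cmult:
  "Ck (length is) u \<Longrightarrow> iter_partial is (\<lambda>\<xi>. c * u \<xi>) \<xi> = c * iter_partial is u \<xi>"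
proof (induction "is" arbitrary: u)
  case (Cons j js)
  have "partial j (\<lambda>\<xi>. c * u \<xi>) = (\<lambda>\<xi>. c * partial j u \<xi>)"
    using Cons.prems by (auto simp: partial_mult)
  then show ?case using Cons by simp
qed simp

lemma iter_partial_sum:
  "finite I \<Longrightarrow> (\<And>i. i \<in> I \<Longrightarrow> Ck (length is) (u i)) \<Longrightarrow>
    iter_partial is (\<lambda>\<xi>. \<Sum>i\<in>I. u i \<xi>) \<xi> = (\<Sum>i\<in>I. iter_partial is (u i) \<xi>)"
proof (induction I rule: finite_induct)
  case empty
  then show ?case by (simp add: iter_partial_const)
next
  case (insert a I)
  then show ?case
    by (simp add: iter_partial_add Ck_sum)
qed

section \<open>Symmetry of higher derivatives\<close>

text \<open>The mean value theorem applied twice, once in each coordinate direction, expresses a second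
difference by a mixed derivative at an intermediate point.\<close>

lemma second_difference_mean_value:
  fixes u :: "real^'n \<Rightarrow> real"
  assumes "Ck 2 u" and "0 < s"
  shows "\<exists>a b. 0 < a \<and> a < s \<and> 0 < b \<and> b < s \<and>
    u (\<xi> + s *\<^sub>R axis i 1 + s *\<^sub>R axis j 1) - u (\<xi> + s *\<^sub>R axis i 1) - u (\<xi> + s *\<^sub>R axis j 1) + u \<xi>
      = s * s * partial j (partial i u) (\<xi> + a *\<^sub>R axis i 1 + b *\<^sub>R axis j 1)"
proof -
  have du: "u differentiable (at \<zeta>)" "partial i u differentiable (at \<zeta>)" for \<zeta>
    using assms(1) by (auto simp: numeral_2_eq_2)
  have dir: "((\<lambda>r. w (\<zeta> + r *\<^sub>R axis l 1)) has_field_derivative partial l w (\<zeta> + r *\<^sub>R axis l 1)) (at r)"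
    if "\<And>\<zeta>. w differentiable (at \<zeta>)" for w :: "real^'n \<Rightarrow> real" and \<zeta> l r
  proof -
    have "((\<lambda>r. \<zeta> + r *\<^sub>R axis l (1::real)) has_derivative (\<lambda>s. s *\<^sub>R axis l 1)) (at r)"
      by (auto intro!: derivative_eq_intros)
    from has_derivative_compose[OF this has_derivative_partials[OF that]]
    have "((\<lambda>r. w (\<zeta> + r *\<^sub>R axis l 1)) has_derivative
       (\<lambda>s. \<Sum>j\<in>UNIV. partial j w (\<zeta> + r *\<^sub>R axis l 1) * (s *\<^sub>R axis l (1::real)) $ j)) (at r)" .
    moreover have "(\<Sum>j\<in>UNIV. c j * (s *\<^sub>R axis l (1::real)) $ j) = c l * s" for c and s :: real
    proof -
      have "(\<Sum>j\<in>UNIV. c j * (s *\<^sub>R axis l (1::real)) $ j) = (\<Sum>j\<in>UNIV. if j = l then c j * s else 0)"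
        by (rule sum.cong) (auto simp: axis_def)
      then show ?thesis by simp
    qed
    ultimately show ?thesis by (simp add: has_field_derivative_def)
  qed
  define g where "g r = u (\<xi> + r *\<^sub>R axis i 1 + s *\<^sub>R axis j 1) - u (\<xi> + r *\<^sub>R axis i 1)" for r
  have g': "(g has_field_derivative
      partial i u (\<xi> + r *\<^sub>R axis i 1 + s *\<^sub>R axis j 1) - partial i u (\<xi> + r *\<^sub>R axis i 1)) (at r)" for r
  proof -
    have *: "\<xi> + r *\<^sub>R axis i 1 + s *\<^sub>R axis j 1 = (\<xi> + s *\<^sub>R axis j 1) + r *\<^sub>R axis i 1" for r
      by simp
    show ?thesis
      unfolding g_def * by (intro DERIV_diff dir du)
  qed
  obtain a where a: "0 < a" "a < s" "g s - g 0 = s *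
      (partial i u (\<xi> + a *\<^sub>R axis i 1 + s *\<^sub>R axis j 1) - partial i u (\<xi> + a *\<^sub>R axis i 1))"
    using MVT2[OF \<open>0 < s\<close>, of g] g' by force
  obtain b where b: "0 < b" "b < s" 
      "partial i u (\<xi> + a *\<^sub>R axis i 1 + s *\<^sub>R axis j 1) - partial i u (\<xi> + a *\<^sub>R axis i 1 + 0 *\<^sub>R axis j 1) =
      s * partial j (partial i u) (\<xi> + a *\<^sub>R axis i 1 + b *\<^sub>R axis j 1)"
    using MVT2[OF \<open>0 < s\<close>, of "\<lambda>r. partial i u (\<xi> + a *\<^sub>R axis i 1 + r *\<^sub>R axis j 1)", OF dir[OF du(2)]]
    by force
  show ?thesis
    using a b by (intro exI[of _ a] exI[of _ b]) (simp add: g_def)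
qed

text \<open>The second difference is symmetric in the two directions, so after division by \<open>s\<^sup>2\<close> its limit is
both mixed derivatives.\<close>

lemma partial_commute:
  fixes u :: "real^'n \<Rightarrow> real"
  assumes "Ck 2 u"
  shows "partial i (partial j u) = partial j (partial i u)"
proof
  fix \<xi> :: "real^'n"
  define D where "D s i j = u (\<xi> + s *\<^sub>R axis i 1 + s *\<^sub>R axis j 1) - u (\<xi> + s *\<^sub>R axis i 1)
    - u (\<xi> + s *\<^sub>R axis j 1) + u \<xi>" for s :: real and i j
  have lim: "((\<lambda>s. D s i j / (s * s)) \<longlongrightarrow> partial j (partial i u) \<xi>) (at_right 0)" for i j
  proof -
    have "\<forall>s. \<exists>ab. 0 < s \<longrightarrow> 0 < fst ab \<and> fst ab < s \<and> 0 < snd ab \<and> snd ab < s \<and> D s i j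
       = s * s * partial j (partial i u) (\<xi> + fst ab *\<^sub>R axis i 1 + snd ab *\<^sub>R axis j 1)"
      unfolding D_def using second_difference_mean_value[OF assms] by (metis fst_conv snd_conv)
    then obtain ab where ab: "0 < s \<longrightarrow> 0 < fst (ab s) \<and> fst (ab s) < s \<and> 0 < snd (ab s) \<and>
        snd (ab s) < s \<and> D s i j = s * s *
          partial j (partial i u) (\<xi> + fst (ab s) *\<^sub>R axis i 1 + snd (ab s) *\<^sub>R axis j 1)" for s
      by metis
    have ev: "eventually (\<lambda>s::real. 0 < s) (at_right 0)"
      by (rule eventually_at_right_less)
    have id: "((\<lambda>s::real. s) \<longlongrightarrow> 0) (at_right 0)" by (rule tendsto_ident_at)
    have "((\<lambda>s. fst (ab s)) \<longlongrightarrow> 0) (at_right 0)" "((\<lambda>s. snd (ab s)) \<longlongrightarrow> 0) (at_right 0)"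
      by (rule tendsto_sandwich[OF _ _ tendsto_const id]; use ev in eventually_elim; use ab in force)+
    then have "((\<lambda>s. \<xi> + fst (ab s) *\<^sub>R axis i 1 + snd (ab s) *\<^sub>R axis j 1) \<longlongrightarrow>
        \<xi> + 0 *\<^sub>R axis i 1 + 0 *\<^sub>R axis j 1) (at_right 0)"
      by (intro tendsto_intros)
    moreover have "isCont (partial j (partial i u)) \<xi>"
      using assms by (auto simp: numeral_2_eq_2 continuous_on_eq_continuous_at)
    ultimately have "((\<lambda>s. partial j (partial i u) (\<xi> + fst (ab s) *\<^sub>R axis i 1 + snd (ab s) *\<^sub>R axis j 1))
        \<longlongrightarrow> partial j (partial i u) \<xi>) (at_right 0)"
      by (intro isCont_tendsto_compose[of \<xi> "partial j (partial i u)"]) auto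
    then show ?thesis
      by (rule Lim_transform_eventually)
         (use ev in eventually_elim; use ab in auto)
  qed
  have "D s i j = D s j i" for s
    by (simp add: D_def algebra_simps)
  then have "((\<lambda>s. D s i j / (s * s)) \<longlongrightarrow> partial i (partial j u) \<xi>) (at_right 0)"
    using lim[of j i] by simp
  with lim[of i j] show "partial i (partial j u) \<xi> = partial j (partial i u) \<xi>"
    by (intro tendsto_unique[of "at_right 0"]) auto
qed

text \<open>Repeated exchange of neighbouring directions brings the chosen one to the front.\<close>

lemma iter_partial_move_to_front:
  fixes u :: "real^'n \<Rightarrow> real"
  assumes "Ck (length is) u" "a \<in> set is"
  shows "iter_partial is u = iter_partial (a # remove1 a is) u"
  using assms
proof (induction "is" arbitrary: u)
  case (Cons j js)
  show ?case
  proof (cases "j = a")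
    case False
    then have a: "a \<in> set js" using Cons.prems by simp
    then have "Suc 0 \<le> length js" by (cases js) auto
    then have "Ck 2 u" using Ck_mono[OF Cons.prems(1)] by simp
    have "iter_partial (j # js) u = iter_partial (a # remove1 a js) (partial j u)"
      using Cons a by simp
    also have "\<dots> = iter_partial (a # remove1 a (j # js)) u"
      using False partial_commute[OF \<open>Ck 2 u\<close>, of a j] by simp
    finally show ?thesis .
  qed simp
qed simp

lemma iter_partial_mset:
  fixes u :: "real^'n \<Rightarrow> real"
  assumes "Ck (length is) u" "mset is = mset js"
  shows "iter_partial is u = iter_partial js u"
  using assms
proof (induction "is" arbitrary: js u)
  case (Cons i "is")
  have "i \<in> set js" using Cons.prems(2) by (metis list.set_intros(1) set_mset_mset)
  have len: "length js = length (i # is)" using Cons.prems(2) mset_eq_length by metis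
  have "mset is = mset (remove1 i js)"
    using Cons.prems(2) by (metis mset_remove1 remove1.simps(2))
  then have "iter_partial (i # is) u = iter_partial (i # remove1 i js) u"
    using Cons by simp
  also have "\<dots> = iter_partial js u"
    using iter_partial_move_to_front[of js u i] \<open>i \<in> set js\<close> Cons.prems(1) len by simp
  finally show ?case .
qed simp

text \<open>A derivative tensor of order \<open>l\<close> of a function of class \<open>C\<^sup>l\<close> is a symmetric tensor.\<close>

lemma Dt_mset:
  "Ck (length is) u \<Longrightarrow> mset is = mset js \<Longrightarrow> Dt u \<xi> is = Dt u \<xi> js"
  unfolding Dt_def using iter_partial_mset by metis

section \<open>Shuffles and complementary sublists\<close>

text \<open>The sublist at the positions in a set, written so that it depends on the set through its
increasing enumeration only; this is the form in which it meets the shuffles below.\<close>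

lemma nths_conv_map_nth:
  "nths xs S = map ((!) xs) (sorted_list_of_set (S \<inter> {..<length xs}))"
proof -
  have "nths [0..<length xs] S = sorted_list_of_set (S \<inter> {..<length xs})"
    by (rule sorted_distinct_set_unique)
       (auto simp: sorted_nths set_nths intro!: exI)
  then show ?thesis
    using nths_map[of "(!) xs" "[0..<length xs]" S] by (simp add: map_nth)
qed

lemma nths_cong:
  "S \<inter> {..<length xs} = S' \<inter> {..<length xs} \<Longrightarrow> nths xs S = nths xs S'"
  by (simp add: nths_conv_map_nth)

lemma nths_one: "p < length xs \<Longrightarrow> nths xs {p} = [xs ! p]"
proof -
  assume "p < length xs"
  then have "{p} \<inter> {..<length xs} = {p}" by auto
  then show ?thesis by (simp add: nths_conv_map_nth)
qed

lemma mset_nths_partition: "mset (nths xs S) + mset (nths xs (- S)) = mset xs"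
proof (induction xs arbitrary: S)
  case (Cons x xs)
  have "{j. Suc j \<in> - S} = - {j. Suc j \<in> S}" by auto
  then show ?case using Cons[of "{j. Suc j \<in> S}"] by (auto simp: nths_Cons)
qed simp

lemma mset_replace:
  assumes "p < length xs"
  shows "mset (r # nths xs (- {p})) = mset (xs[p := r])"
proof -
  have "mset xs = add_mset (xs ! p) (mset (nths xs (- {p})))"
    using mset_nths_partition[of xs "{p}"] assms by (simp add: nths_one)
  with assms show ?thesis by (simp add: mset_update)
qed

lemma strict_mono_on_list:
  fixes \<sigma> :: "nat \<Rightarrow> nat"
  assumes "strict_mono_on {a..<b} \<sigma>"
  shows "map \<sigma> [a..<b] = sorted_list_of_set (\<sigma> ` {a..<b})"
proof (rule sorted_distinct_set_unique)
  have "mono_on {a..<b} \<sigma>" "inj_on \<sigma> {a..<b}"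
    using assms by (auto intro: strict_mono_on_imp_mono_on strict_mono_on_imp_inj_on)
  then show "sorted (map \<sigma> [a..<b])" "distinct (map \<sigma> [a..<b])"
    by (simp_all add: sorted_map_mono distinct_map)
qed auto

text \<open>A shuffle is increasing on each of its two blocks, so on each block it is the increasing
enumeration of its image there, and the second image is the complement of the first.\<close>

lemma shuffle_perms_lists:
  assumes "\<sigma> \<in> shuffle_perms i j"
  shows "map \<sigma> [0..<i] = sorted_list_of_set (\<sigma> ` {..<i})"
    and "map \<sigma> [i..<i+j] = sorted_list_of_set ({..<i+j} - \<sigma> ` {..<i})"
proof -
  have p: "\<sigma> permutes {..<i+j}" and m: "strict_mono_on {0..<i} \<sigma>" "strict_mono_on {i..<i+j} \<sigma>"
    using assms by (auto simp: shuffle_perms_def atLeast0LessThan)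
  show "map \<sigma> [0..<i] = sorted_list_of_set (\<sigma> ` {..<i})"
    using strict_mono_on_list[OF m(1)] by (simp add: atLeast0LessThan)
  have "\<sigma> ` {i..<i+j} = \<sigma> ` ({..<i+j} - {..<i})"
    by (rule arg_cong[of _ _ "image \<sigma>"]) auto
  also have "\<dots> = \<sigma> ` {..<i+j} - \<sigma> ` {..<i}"
    using permutes_inj[OF p] by (rule image_set_diff)
  finally show "map \<sigma> [i..<i+j] = sorted_list_of_set ({..<i+j} - \<sigma> ` {..<i})"
    using strict_mono_on_list[OF m(2)] permutes_image[OF p] by simp
qed

text \<open>By the preceding lemma a shuffle is determined by the image of its first block. Conversely the
increasing enumerations of a set of the right size and of its complement form a shuffle.\<close>

lemma bij_betw_shuffle_perms:
  "bij_betw (\<lambda>\<sigma>. \<sigma> ` {..<i}) (shuffle_perms i j) {S. S \<subseteq> {..<i+j} \<and> card S = i}"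
  unfolding bij_betw_def
proof (intro conjI subset_antisym subsetI)
  show "inj_on (\<lambda>\<sigma>. \<sigma> ` {..<i}) (shuffle_perms i j)"
  proof (rule inj_onI, rule ext)
    fix \<sigma> \<tau> n
    assume st: "\<sigma> \<in> shuffle_perms i j" "\<tau> \<in> shuffle_perms i j" "\<sigma> ` {..<i} = \<tau> ` {..<i}"
    then have "map \<sigma> [0..<i] = map \<tau> [0..<i]" "map \<sigma> [i..<i+j] = map \<tau> [i..<i+j]"
      by (simp_all only: shuffle_perms_lists[OF st(1)] shuffle_perms_lists[OF st(2)])
    then have "\<sigma> n = \<tau> n" if "n < i + j"
      using that by (cases "n < i") (simp_all add: map_eq_conv)
    moreover have "\<sigma> n = \<tau> n" if "\<not> n < i + j"
      using that st(1,2) permutes_not_in[of \<sigma> "{..<i+j}" n]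
        permutes_not_in[of \<tau> "{..<i+j}" n] by (simp add: shuffle_perms_def)
    ultimately show "\<sigma> n = \<tau> n" by blast
  qed
next
  fix S assume "S \<in> (\<lambda>\<sigma>. \<sigma> ` {..<i}) ` shuffle_perms i j"
  then obtain \<sigma> where \<sigma>: "\<sigma> permutes {..<i+j}" "S = \<sigma> ` {..<i}"
    by (auto simp: shuffle_perms_def)
  have "S \<subseteq> \<sigma> ` {..<i+j}" using \<sigma>(2) by auto
  moreover have "card S = i"
    unfolding \<sigma>(2) using card_image[OF permutes_inj_on[OF \<sigma>(1)], of "{..<i}"] by simp
  ultimately show "S \<in> {S. S \<subseteq> {..<i+j} \<and> card S = i}"
    unfolding permutes_image[OF \<sigma>(1)] by simp
next
  fix S assume "S \<in> {S. S \<subseteq> {..<i+j} \<and> card S = i}"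
  then have S: "S \<subseteq> {..<i+j}" "card S = i" by auto
  then have "finite S" by (meson finite_lessThan finite_subset)
  note S = S this
  \<comment> \<open>The two increasing enumerations, one after the other, are the values of the shuffle.\<close>
  define xs where "xs = sorted_list_of_set S @ sorted_list_of_set ({..<i+j} - S)"
  define \<sigma> where "\<sigma> n = (if n < i + j then xs ! n else n)" for n
  have len: "length xs = i + j"
    using S by (simp add: xs_def card_Diff_subset)
  have set: "set xs = {..<i+j}" and dist: "distinct xs"
    using S by (auto simp: xs_def)
  have "bij_betw ((!) xs) {..<i+j} {..<i+j}"
    using bij_betw_nth[OF dist refl refl] by (simp only: len set)
  moreover have "\<And>n. n \<in> {..<i+j} \<Longrightarrow> \<sigma> n = xs ! n"
    by (simp add: \<sigma>_def)
  ultimately have "bij_betw \<sigma> {..<i+j} {..<i+j}"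
    using bij_betw_cong[of "{..<i+j}" \<sigma> "(!) xs"] by blast
  then have "\<sigma> permutes {..<i+j}"
    by (rule bij_imp_permutes) (simp add: \<sigma>_def)
  moreover have "strict_mono_on {..<i} \<sigma>"
  proof (rule strict_mono_onI)
    fix r s :: nat assume "r \<in> {..<i}" "s \<in> {..<i}" "r < s"
    then show "\<sigma> r < \<sigma> s"
      using S sorted_wrt_nth_less[OF strict_sorted_list_of_set[of S], of r s]
      by (simp add: \<sigma>_def xs_def nth_append)
  qed
  moreover have "strict_mono_on {i..<i+j} \<sigma>"
  proof (rule strict_mono_onI)
    fix r s :: nat assume "r \<in> {i..<i+j}" "s \<in> {i..<i+j}" "r < s"
    then show "\<sigma> r < \<sigma> s"
      using S sorted_wrt_nth_less[OF strict_sorted_list_of_set[of "{..<i+j} - S"], of "r - i" "s - i"]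
      by (simp add: \<sigma>_def xs_def nth_append card_Diff_subset)
  qed
  moreover have "\<sigma> ` {..<i} = S"
  proof -
    have "\<sigma> ` {..<i} = (!) (sorted_list_of_set S) ` {0..<length (sorted_list_of_set S)}"
      using S by (intro image_cong) (auto simp: \<sigma>_def xs_def nth_append)
    also have "\<dots> = S"
      using S(3) by (simp only: nth_image[OF order_refl] take_all_iff set_sorted_list_of_set take_all order_refl)
    finally show ?thesis .
  qed
  ultimately show "S \<in> (\<lambda>\<sigma>. \<sigma> ` {..<i}) ` shuffle_perms i j"
    by (auto simp: shuffle_perms_def)
qed

text \<open>Under the bijection between shuffles and sets of positions, the permuted index list splits into the
sublist on the set and the sublist on its complement. This set-indexed form of the shuffle
symmetrization is the one that the Leibniz rule produces.\<close>

lemma sym_shuffle_contract11: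
  assumes len: "length is = i + j"
  shows "sym_shuffle i j (contract11 i A B) is =
    (\<Sum>S | S \<subseteq> {..<i+j} \<and> card S = i. \<Sum>r\<in>UNIV. A r (nths is S) * B r (nths is (- S)))"
proof -
  have "contract11 i A B (permute_list \<sigma> is) =
      (\<Sum>r\<in>UNIV. A r (nths is (\<sigma> ` {..<i})) * B r (nths is (- \<sigma> ` {..<i})))"
    if s: "\<sigma> \<in> shuffle_perms i j" for \<sigma>
  proof -
    have p: "\<sigma> permutes {..<i+j}" using s by (simp add: shuffle_perms_def)
    have "\<sigma> ` {..<i} \<subseteq> \<sigma> ` {..<i+j}" by auto
    then have sub: "\<sigma> ` {..<i} \<inter> {..<i+j} = \<sigma> ` {..<i}" 
        "- \<sigma> ` {..<i} \<inter> {..<i+j} = {..<i+j} - \<sigma> ` {..<i}"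
      using permutes_image[OF p] by auto
    have "take i (permute_list \<sigma> is) = map ((!) is) (map \<sigma> [0..<i])"
      "drop i (permute_list \<sigma> is) = map ((!) is) (map \<sigma> [i..<i+j])"
      using len by (simp_all add: permute_list_def take_map drop_map comp_def)
    then show ?thesis
      by (simp only: contract11_def nths_conv_map_nth len sub shuffle_perms_lists[OF s])
  qed
  then have "sym_shuffle i j (contract11 i A B) is = (\<Sum>\<sigma>\<in>shuffle_perms i j.
      \<Sum>r\<in>UNIV. A r (nths is (\<sigma> ` {..<i})) * B r (nths is (- \<sigma> ` {..<i})))"
    by (simp add: sym_shuffle_def)
  also have "\<dots> = (\<Sum>S | S \<subseteq> {..<i+j} \<and> card S = i.
      \<Sum>r\<in>UNIV. A r (nths is S) * B r (nths is (- S)))"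
    by (rule sum.reindex_bij_betw[OF bij_betw_shuffle_perms,
          of "\<lambda>S. \<Sum>r\<in>UNIV. A r (nths is S) * B r (nths is (- S))"])
  finally show ?thesis .
qed

lemma sym_shuffle_0_left:
  assumes "length is = l"
  shows "sym_shuffle 0 l (contract11 0 A B) is = (\<Sum>r\<in>UNIV. A r [] * B r is)"
proof -
  have "{S. S \<subseteq> {..<l} \<and> card S = 0} = {{}}"
    by (auto dest: finite_subset)
  then show ?thesis
    using sym_shuffle_contract11[of "is" 0 l A B] assms by (simp add: nths_all)
qed

lemma sym_shuffle_0_right:
  assumes "length is = l"
  shows "sym_shuffle l 0 (contract11 l A B) is = (\<Sum>r\<in>UNIV. A r is * B r [])"
proof -
  have "{S. S \<subseteq> {..<l} \<and> card S = l} = {{..<l}}"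
    by (auto dest: card_subset_eq[rotated])
  moreover have "nths is (- {..<l}) = []"
    using assms by (subst nths_cong[of _ "is" "{}"]) auto
  ultimately show ?thesis
    using sym_shuffle_contract11[of "is" l 0 A B] assms by (simp add: nths_all)
qed

lemma sym_shuffle_1_left:
  assumes "length is = Suc j"
  shows "sym_shuffle 1 j (contract11 1 A B) is =
    (\<Sum>p<Suc j. \<Sum>r\<in>UNIV. A r [is ! p] * B r (nths is (- {p})))"
proof -
  have *: "{S. S \<subseteq> {..<Suc j} \<and> card S = Suc 0} = (\<lambda>p. {p}) ` {..<Suc j}"
    by (auto simp: card_Suc_eq)
  have "sym_shuffle 1 j (contract11 1 A B) is =
      (\<Sum>S\<in>(\<lambda>p. {p}) ` {..<Suc j}. \<Sum>r\<in>UNIV. A r (nths is S) * B r (nths is (- S)))"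
    using sym_shuffle_contract11[of "is" 1 j A B] assms by (simp add: *)
  also have "\<dots> = (\<Sum>p<Suc j. \<Sum>r\<in>UNIV. A r (nths is {p}) * B r (nths is (- {p})))"
    by (subst sum.reindex) (auto simp: inj_on_def)
  also have "\<dots> = (\<Sum>p<Suc j. \<Sum>r\<in>UNIV. A r [is ! p] * B r (nths is (- {p})))"
    using assms by (intro sum.cong refl) (simp add: nths_one)
  finally show ?thesis .
qed

lemma sym_shuffle_1_right:
  assumes "length is = Suc j"
  shows "sym_shuffle j 1 (contract11 j A B) is =
    (\<Sum>p<Suc j. \<Sum>r\<in>UNIV. A r (nths is (- {p})) * B r [is ! p])"
proof -
  have *: "{S. S \<subseteq> {..<Suc j} \<and> card S = j} = (\<lambda>p. {..<Suc j} - {p}) ` {..<Suc j}"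
  proof (intro subset_antisym subsetI)
    fix S assume "S \<in> {S. S \<subseteq> {..<Suc j} \<and> card S = j}"
    then have S: "S \<subseteq> {..<Suc j}" "card S = j" by auto
    then have "card ({..<Suc j} - S) = Suc 0"
      by (simp add: card_Diff_subset finite_subset)
    then obtain p where "{..<Suc j} - S = {p}" by (auto simp: card_Suc_eq)
    with S show "S \<in> (\<lambda>p. {..<Suc j} - {p}) ` {..<Suc j}"
      by (intro image_eqI[of _ _ p]) auto
  qed auto
  have "sym_shuffle j 1 (contract11 j A B) is =
      (\<Sum>S\<in>(\<lambda>p. {..<Suc j} - {p}) ` {..<Suc j}. \<Sum>r\<in>UNIV. A r (nths is S) * B r (nths is (- S)))"
    using sym_shuffle_contract11[of "is" j 1 A B] assms by (simp add: *)
  also have "\<dots> = (\<Sum>p<Suc j. \<Sum>r\<in>UNIV. A r (nths is ({..<Suc j} - {p})) *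
      B r (nths is (- ({..<Suc j} - {p}))))"
    by (subst sum.reindex) (auto simp: inj_on_def)
  also have "\<dots> = (\<Sum>p<Suc j. \<Sum>r\<in>UNIV. A r (nths is (- {p})) * B r [is ! p])"
  proof (intro sum.cong refl)
    fix p r assume "p \<in> {..<Suc j}"
    then have "nths is (- ({..<Suc j} - {p})) = [is ! p]"
      using assms by (subst nths_cong[of _ "is" "{p}"]) (auto simp: nths_one)
    moreover have "nths is ({..<Suc j} - {p}) = nths is (- {p})"
      using assms by (intro nths_cong) auto
    ultimately show "A r (nths is ({..<Suc j} - {p})) * B r (nths is (- ({..<Suc j} - {p}))) =
        A r (nths is (- {p})) * B r [is ! p]"
      by simp
  qed
  finally show ?thesis .
qed

text \<open>A set of positions of a nonempty list either contains the first position or not.\<close>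

lemma sum_Pow_lessThan_Suc:
  fixes g :: "nat set \<Rightarrow> 'a::comm_monoid_add"
  shows "(\<Sum>S\<in>Pow {..<Suc n}. g S) = (\<Sum>S\<in>Pow {..<n}. g (insert 0 (Suc ` S)) + g (Suc ` S))"
proof -
  have P: "Pow {..<Suc n} = (\<lambda>S. Suc ` S) ` Pow {..<n} \<union> (\<lambda>S. insert 0 (Suc ` S)) ` Pow {..<n}"
    by (simp add: lessThan_Suc_eq_insert_0 Pow_insert image_Pow_surj[OF refl, symmetric] image_image)
  have inj: "inj_on (\<lambda>S. Suc ` S) (Pow {..<n})"
    "inj_on (\<lambda>S. insert 0 (Suc ` S)) (Pow {..<n})"
    by (auto simp: inj_on_def)
  show ?thesis
    unfolding P
    by (subst sum.union_disjoint) (auto simp: sum.reindex[OF inj(1)] sum.reindex[OF inj(2)] sum.distrib add.commute)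
qed

lemma sum_Pow_by_card:
  "(\<Sum>S\<in>Pow {..<l}. g S) = (\<Sum>i\<le>l. \<Sum>S | S \<subseteq> {..<l::nat} \<and> card S = i. g S)"
proof -
  have "card S \<le> l" if "S \<subseteq> {..<l}" for S
    using card_mono[OF _ that] by simp
  then have "(\<Sum>i\<le>l. \<Sum>S\<in>{S \<in> Pow {..<l}. card S = i}. g S) = (\<Sum>S\<in>Pow {..<l}. g S)"
    by (intro sum.group) auto
  then show ?thesis by simp
qed

section \<open>The Leibniz rule for derivative tensors\<close>

text \<open>Each direction of differentiation hits one of the two factors; the summands are indexed by the set
of positions whose direction hits the first one. Within each factor the directions
keep their order, as in a shuffle.\<close>

lemma iter_partial_mult:
  fixes u v :: "real^'n \<Rightarrow> real"
  assumes "Ck (length is) u" "Ck (length is) v"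
  shows "iter_partial is (\<lambda>\<zeta>. u \<zeta> * v \<zeta>) \<xi> =
    (\<Sum>S\<in>Pow {..<length is}. iter_partial (nths is S) u \<xi> * iter_partial (nths is (- S)) v \<xi>)"
  using assms
proof (induction "is" arbitrary: u v)
  case Nil
  then show ?case by simp
next
  case (Cons j js)
  have C: "Ck (length js) u" "Ck (length js) v" "Ck (length js) (partial j u)"
      "Ck (length js) (partial j v)"
    using Cons.prems Ck_SucD by auto
  have "partial j (\<lambda>\<zeta>. u \<zeta> * v \<zeta>) = (\<lambda>\<zeta>. partial j u \<zeta> * v \<zeta> + u \<zeta> * partial j v \<zeta>)"
    using Cons.prems by (auto simp: partial_mult)
  then have "iter_partial (j # js) (\<lambda>\<zeta>. u \<zeta> * v \<zeta>) \<xi> =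
      (\<Sum>S\<in>Pow {..<length js}. iter_partial (nths js S) (partial j u) \<xi> * iter_partial (nths js (- S)) v \<xi>
        + iter_partial (nths js S) u \<xi> * iter_partial (nths js (- S)) (partial j v) \<xi>)"
    using C by (simp add: iter_partial_add Ck_mult Cons.IH sum.distrib)
  also have "\<dots> = (\<Sum>S\<in>Pow {..<length js}.
      iter_partial (nths (j # js) (insert 0 (Suc ` S))) u \<xi> *
        iter_partial (nths (j # js) (- insert 0 (Suc ` S))) v \<xi>
      + iter_partial (nths (j # js) (Suc ` S)) u \<xi> * iter_partial (nths (j # js) (- Suc ` S)) v \<xi>)"
  proof -
    have "{i. Suc i \<in> insert 0 (Suc ` S)} = S" "{i. Suc i \<in> Suc ` S} = S"
      "{i. Suc i \<in> - insert 0 (Suc ` S)} = - S" "{i. Suc i \<in> - Suc ` S} = - S" for S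
      by auto
    then show ?thesis by (simp add: nths_Cons)
  qed
  finally show ?case
    by (simp add: sum_Pow_lessThan_Suc)
qed

text \<open>Sorting the sets of positions in the Leibniz rule by their size gives one shuffle symmetrization
for each order of differentiation of the first factor.\<close>

lemma Dt_sum_mult:
  fixes u v :: "'r::finite \<Rightarrow> real^'n \<Rightarrow> real"
  assumes "\<And>r. Ck (length is) (u r)" "\<And>r. Ck (length is) (v r)"
  shows "Dt (\<lambda>\<zeta>. \<Sum>r\<in>UNIV. u r \<zeta> * v r \<zeta>) \<xi> is =
    (\<Sum>i\<le>length is. sym_shuffle i (length is - i)
      (contract11 i (\<lambda>r. Dt (u r) \<xi>) (\<lambda>r. Dt (v r) \<xi>)) is)"
proof -
  have "Dt (\<lambda>\<zeta>. \<Sum>r\<in>UNIV. u r \<zeta> * v r \<zeta>) \<xi> is =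
      (\<Sum>r\<in>UNIV. \<Sum>S\<in>Pow {..<length is}. Dt (u r) \<xi> (nths is S) * Dt (v r) \<xi> (nths is (- S)))"
    using assms by (simp add: Dt_def iter_partial_sum Ck_mult iter_partial_mult)
  also have "\<dots> = (\<Sum>S\<in>Pow {..<length is}.
      \<Sum>r\<in>UNIV. Dt (u r) \<xi> (nths is S) * Dt (v r) \<xi> (nths is (- S)))"
    by (rule sum.swap)
  also have "\<dots> = (\<Sum>i\<le>length is. sym_shuffle i (length is - i)
      (contract11 i (\<lambda>r. Dt (u r) \<xi>) (\<lambda>r. Dt (v r) \<xi>)) is)"
    by (simp add: sum_Pow_by_card sym_shuffle_contract11)
  finally show ?thesis .
qed

lemma sum_atMost_ends:
  fixes g :: "nat \<Rightarrow> 'a::comm_monoid_add"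
  assumes "1 \<le> l"
  shows "(\<Sum>i\<le>l. g i) = g 0 + (\<Sum>i=1..l-1. g i) + g l"
proof -
  have "{..l} = insert 0 (insert l {1..l-1})" using assms by auto
  then show ?thesis using assms by (simp add: ac_simps)
qed

lemma sym_shuffle_contract11_cong:
  assumes "length is = i + j"
    and "\<And>js ks r. length js = i \<Longrightarrow> length ks = j \<Longrightarrow> A r js * B r ks = A' r js * B' r ks"
  shows "sym_shuffle i j (contract11 i A B) is = sym_shuffle i j (contract11 i A' B') is"
  using assms by (simp add: sym_shuffle_def contract11_def)

lemma Dt_linear_combination:
  assumes "\<And>s. Ck (length is) (w s)"
  shows "Dt (\<lambda>\<zeta>. \<Sum>s\<in>UNIV. C $ r $ s * w s \<zeta>) \<xi> is = contract21 C (\<lambda>s. Dt (w s) \<xi>) r is"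
  using assms by (simp add: Dt_def contract21_def iter_partial_sum iter_partial_cmult Ck_mult)

text \<open>In the two extreme summands of the Leibniz rule one of the factors is not differentiated, and they
agree because the matrix is symmetric.\<close>

lemma Dt_quadratic:
  fixes w :: "'r::finite \<Rightarrow> real^'n \<Rightarrow> real"
  assumes w: "\<And>r. Ck (length is) (w r)" and A: "transpose A = A" and len: "1 \<le> length is"
  shows "Dt (\<lambda>\<zeta>. \<Sum>r\<in>UNIV. w r \<zeta> * (\<Sum>s\<in>UNIV. A $ r $ s * w s \<zeta>)) \<xi> is =
    2 * (\<Sum>r\<in>UNIV. Dt (w r) \<xi> is * (\<Sum>s\<in>UNIV. A $ r $ s * w s \<xi>)) +
    (\<Sum>i=1..length is - 1. sym_shuffle i (length is - i)
      (contract11 i (\<lambda>r. Dt (w r) \<xi>) (contract21 A (\<lambda>r. Dt (w r) \<xi>))) is)"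
proof -
  define l where "l = length is"
  define v where "v = (\<lambda>r \<zeta>. \<Sum>s\<in>UNIV. A $ r $ s * w s \<zeta>)"
  have v: "Ck l (v r)" for r
    unfolding v_def using w by (auto simp: l_def intro!: Ck_sum Ck_mult)
  have Dv: "Dt (v r) \<xi> js = contract21 A (\<lambda>r. Dt (w r) \<xi>) r js" if "length js \<le> l" for js r
    unfolding v_def using Ck_mono[OF w] that by (intro Dt_linear_combination) (simp add: l_def)
  have sym: "A $ r $ s = A $ s $ r" for r s
    using A by (metis transpose_def vec_lambda_beta)
  define g where "g i = sym_shuffle i (l - i)
    (contract11 i (\<lambda>r. Dt (w r) \<xi>) (contract21 A (\<lambda>r. Dt (w r) \<xi>))) is" for i
  have "Dt (\<lambda>\<zeta>. \<Sum>r\<in>UNIV. w r \<zeta> * v r \<zeta>) \<xi> is = (\<Sum>i\<le>l. sym_shuffle i (l - i)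
      (contract11 i (\<lambda>r. Dt (w r) \<xi>) (\<lambda>r. Dt (v r) \<xi>)) is)"
    using Dt_sum_mult[of "is" w v \<xi>] w v by (simp add: l_def)
  also have "\<dots> = (\<Sum>i\<le>l. g i)"
    unfolding g_def
    by (intro sum.cong refl sym_shuffle_contract11_cong) (auto simp: l_def Dv)
  also have "\<dots> = g 0 + (\<Sum>i=1..l-1. g i) + g l"
    using len by (intro sum_atMost_ends) (simp add: l_def)
  also have "g 0 = (\<Sum>r\<in>UNIV. Dt (w r) \<xi> is * (\<Sum>s\<in>UNIV. A $ r $ s * w s \<xi>))"
  proof -
    have "g 0 = (\<Sum>r\<in>UNIV. \<Sum>s\<in>UNIV. w r \<xi> * (A $ r $ s * Dt (w s) \<xi> is))"
      by (simp add: g_def sym_shuffle_0_left l_def contract21_def Dt_def sum_distrib_left)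
    also have "\<dots> = (\<Sum>s\<in>UNIV. \<Sum>r\<in>UNIV. w r \<xi> * (A $ r $ s * Dt (w s) \<xi> is))"
      by (rule sum.swap)
    also have "\<dots> = (\<Sum>s\<in>UNIV. \<Sum>r\<in>UNIV. Dt (w s) \<xi> is * (A $ s $ r * w r \<xi>))"
      by (intro sum.cong refl) (subst sym, simp)
    finally show ?thesis by (simp add: sum_distrib_left)
  qed
  also have "g l = (\<Sum>r\<in>UNIV. Dt (w r) \<xi> is * (\<Sum>s\<in>UNIV. A $ r $ s * w s \<xi>))"
    by (simp add: g_def sym_shuffle_0_right l_def contract21_def Dt_def)
  finally show ?thesis by (simp add: g_def l_def v_def)
qed

section \<open>Derivatives of vector-valued maps\<close>

lemma Ck_vec_has_derivative:
  assumes "Ck_vec k g" "1 \<le> k"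
  shows "(g has_derivative (\<lambda>v. \<chi> i. \<Sum>j\<in>UNIV. partial j (\<lambda>\<zeta>. g \<zeta> $ i) \<xi> * v $ j)) (at \<xi>)"
proof -
  have "((\<lambda>\<zeta>. g \<zeta> $ i) has_derivative (\<lambda>v. \<Sum>j\<in>UNIV. partial j (\<lambda>\<zeta>. g \<zeta> $ i) \<xi> * v $ j)) (at \<xi>)"
    for i
    using assms Ck_differentiable by (intro has_derivative_partials) (auto simp: Ck_vec_def)
  then show ?thesis
    unfolding has_derivative_within
    by (auto intro!: vec_tendstoI simp: linear_conv_bounded_linear[symmetric] linear_iff vec_eq_iff)
qed

lemma jacobian_nth:
  assumes "Ck_vec k g" "1 \<le> k"
  shows "jacobian g (at \<xi>) $ i $ j = Dvec g \<xi> i [j]"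
proof -
  note d = Ck_vec_has_derivative[OF assms, of \<xi>]
  have "((\<lambda>\<zeta>. g \<zeta> $ i) has_derivative (\<lambda>v. frechet_derivative g (at \<xi>) v $ i)) (at \<xi>)"
    using differentiableI[OF d]
    by (intro bounded_linear.has_derivative[OF bounded_linear_vec_nth])
       (simp flip: frechet_derivative_works)
  from partial_has_derivative[OF this, of j] show ?thesis
    by (simp add: jacobian_def matrix_def Dvec_def Dt_def)
qed

lemma iter_partial_snoc: "iter_partial (is @ [j]) u = partial j (iter_partial is u)"
  by (induction "is" arbitrary: u) auto

text \<open>The new index of the derivative tensor appears at the end and is moved to the front by symmetry,
which is the mode that the observer equations contract.\<close>

lemma Dt_has_derivative:
  fixes u :: "real^'n \<Rightarrow> real"
  assumes "Ck (Suc (length is)) u"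
  shows "((\<lambda>\<zeta>. Dt u \<zeta> is) has_derivative (\<lambda>v. \<Sum>j\<in>UNIV. Dt u \<xi> (j # is) * v $ j)) (at \<xi>)"
proof -
  have "Ck 1 (iter_partial is u)" using assms by (rule Ck_iter_partialI) simp
  then have "((\<lambda>\<zeta>. Dt u \<zeta> is) has_derivative
      (\<lambda>v. \<Sum>j\<in>UNIV. partial j (iter_partial is u) \<xi> * v $ j)) (at \<xi>)"
    unfolding Dt_def by (intro has_derivative_partials Ck_differentiable) auto
  moreover have "partial j (iter_partial is u) \<xi> = Dt u \<xi> (j # is)" for j
    using Dt_mset[of "j # is" u "is @ [j]" \<xi>] assms by (simp add: Dt_def iter_partial_snoc)
  ultimately show ?thesis by simp
qed

section \<open>Differentiation along a curve\<close>

lemma has_vector_derivative_vecI: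
  fixes f :: "real \<Rightarrow> ('a::real_normed_vector)^'n"
  assumes "\<And>i. ((\<lambda>s. f s $ i) has_vector_derivative d $ i) (at t within S)"
  shows "(f has_vector_derivative d) (at t within S)"
  using assms unfolding has_vector_derivative_def has_derivative_within
  by (auto intro!: vec_tendstoI bounded_linear_scaleR_left)

lemma mean_value_within:
  fixes \<phi> :: "real \<Rightarrow> real"
  assumes "\<And>r. r \<in> {a..b} \<Longrightarrow> (\<phi> has_real_derivative \<phi>' r) (at r within {a..b})"
    and "s \<in> {a..b}" "t \<in> {a..b}"
  shows "\<exists>\<tau>\<in>{a..b}. \<bar>\<tau> - t\<bar> \<le> \<bar>s - t\<bar> \<and> \<phi> s - \<phi> t = (s - t) * \<phi>' \<tau>"
proof -
  have *: "\<exists>\<tau>\<in>{c..d}. \<phi> d - \<phi> c = (d - c) * \<phi>' \<tau>" if "c \<le> d" "c \<in> {a..b}" "d \<in> {a..b}" for c d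
  proof -
    have "(\<phi> has_derivative (\<lambda>h. h * \<phi>' r)) (at r within {c..d})" if "r \<in> {c..d}" for r
      using assms(1)[of r] that \<open>c \<in> _\<close> \<open>d \<in> _\<close>
      by (auto intro!: has_derivative_subset[of \<phi> _ r "{a..b}"]
               simp: has_field_derivative_def mult.commute[of _ "\<phi>' r"])
    with \<open>c \<le> d\<close> show ?thesis
      by (intro mvt_very_simple) auto
  qed
  show ?thesis
  proof (cases "t \<le> s")
    case True
    with *[of t s] assms(2,3) show ?thesis by force
  next
    case False
    then obtain \<tau> where "\<tau> \<in> {s..t}" "\<phi> t - \<phi> s = (t - s) * \<phi>' \<tau>"
      using *[of s t] assms(2,3) by auto
    then show ?thesis
      using assms(2,3) False by (intro bexI[of _ \<tau>]) (auto simp: algebra_simps)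
  qed
qed

text \<open>Only the first argument of \<open>F\<close> varies between the two terms of the difference; the mean value
theorem turns it into the time derivative at an intermediate time, and joint continuity
identifies the limit. Continuity of the curve suffices for this, which allows the lemma to enter
the proof that the observer is differentiable.\<close>

lemma time_increment_has_derivative:
  fixes F :: "real \<Rightarrow> 'a::real_normed_vector \<Rightarrow> real"
  assumes F': "\<And>s \<xi>. s \<in> {a..b} \<Longrightarrow> ((\<lambda>s. F s \<xi>) has_real_derivative F' s \<xi>) (at s within {a..b})"
    and cont: "continuous_on ({a..b} \<times> UNIV) (\<lambda>(s, \<xi>). F' s \<xi>)"
    and x: "continuous (at t within {a..b}) x" and t: "t \<in> {a..b}"
  shows "((\<lambda>s. F s (x s) - F t (x s)) has_real_derivative F' t (x t)) (at t within {a..b})"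
proof -
  have "\<exists>\<tau>. s \<in> {a..b} \<longrightarrow> \<tau> \<in> {a..b} \<and> \<bar>\<tau> - t\<bar> \<le> \<bar>s - t\<bar> \<and>
      F s (x s) - F t (x s) = (s - t) * F' \<tau> (x s)" for s
    using mean_value_within[of a b "\<lambda>s. F s (x s')" "\<lambda>r. F' r (x s')" s t for s'] F' t by metis
  then obtain \<tau> where \<tau>: "s \<in> {a..b} \<longrightarrow> \<tau> s \<in> {a..b} \<and> \<bar>\<tau> s - t\<bar> \<le> \<bar>s - t\<bar> \<and>
      F s (x s) - F t (x s) = (s - t) * F' (\<tau> s) (x s)" for s
    by metis
  have ev: "eventually (\<lambda>s. s \<in> {a..b} \<and> s \<noteq> t) (at t within {a..b})"
    by (auto simp: eventually_at_filter)
  have "(\<tau> \<longlongrightarrow> t) (at t within {a..b})"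
  proof (rule Lim_transform_bound[where g = "\<lambda>s. s - t", THEN LIM_zero_cancel])
    show "eventually (\<lambda>s. norm (\<tau> s - t) \<le> norm (s - t)) (at t within {a..b})"
      using ev by eventually_elim (use \<tau> in auto)
    show "((\<lambda>s. s - t) \<longlongrightarrow> 0) (at t within {a..b})"
      by (rule LIM_zero) (rule tendsto_ident_at)
  qed
  then have lim: "((\<lambda>s. (\<tau> s, x s)) \<longlongrightarrow> (t, x t)) (at t within {a..b})"
    using x by (intro tendsto_Pair) (auto simp: continuous_within)
  have "eventually (\<lambda>s. (\<tau> s, x s) \<in> {a..b} \<times> UNIV) (at t within {a..b})"
    using ev by eventually_elim (use \<tau> in auto)
  from continuous_on_tendsto_compose[OF cont lim _ this] t
  have "((\<lambda>s. F' (\<tau> s) (x s)) \<longlongrightarrow> F' t (x t)) (at t within {a..b})" by simp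
  moreover have "eventually (\<lambda>s. F' (\<tau> s) (x s) =
      ((F s (x s) - F t (x s)) - (F t (x t) - F t (x t))) / (s - t)) (at t within {a..b})"
    using ev by eventually_elim (use \<tau> in auto)
  ultimately show ?thesis
    unfolding has_field_derivative_iff by (rule Lim_transform_eventually)
qed

text \<open>Converse of the chain rule, which takes the place of the implicit function theorem. If the derivative
of \<open>g\<close> has a left inverse \<open>M\<close> and \<open>g \<circ> x\<close> is differentiable, then applying \<open>M\<close> to the expansion of \<open>g\<close> at
\<open>x(t)\<close> first shows that \<open>x(s) - x(t)\<close> is of the order of \<open>s - t\<close>, and then, with this bound, that
the remainder of the expansion is negligible against \<open>s - t\<close>.\<close>

lemma has_vector_derivative_cancel_left:
  fixes g :: "'a::real_normed_vector \<Rightarrow> 'b::real_normed_vector"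
  assumes g: "(g has_derivative L) (at (x t))"
    and M: "bounded_linear M" "\<And>v. M (L v) = v"
    and gx: "((\<lambda>s. g (x s)) has_vector_derivative c) (at t within S)"
    and x: "continuous (at t within S) x"
  shows "(x has_vector_derivative M c) (at t within S)"
proof -
  interpret M: bounded_linear M by fact
  obtain K where K: "K > 0" "\<And>v. norm (M v) \<le> norm v * K"
    using M.pos_bounded by blast
  define C where "C = norm c + 1"
  have C: "C > 0" unfolding C_def by (smt (verit) norm_ge_zero)
  \<comment> \<open>Expansion of \<open>g\<close> at \<open>x(t)\<close>, pulled back along the continuous curve; the estimate is trivial at
    \<open>x(t)\<close> itself, so the curve may return there.\<close>
  have g_ev: "eventually (\<lambda>s. norm (g (x s) - g (x t) - L (x s - x t)) \<le> e * norm (x s - x t))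
      (at t within S)" if "e > 0" for e
  proof -
    have "eventually (\<lambda>z. norm (g z - g (x t) - L (z - x t)) \<le> e * norm (z - x t)) (at (x t))"
      using g that unfolding has_derivative_within_alt2 by blast
    moreover have "L 0 = 0"
      using linear_0[OF has_derivative_linear[OF g]] .
    ultimately have "eventually (\<lambda>z. norm (g z - g (x t) - L (z - x t)) \<le> e * norm (z - x t))
        (nhds (x t))"
      by (simp add: eventually_nhds_conv_at)
    then show ?thesis
      using x unfolding continuous_within by (rule eventually_compose_filterlim)
  qed
  have gx_ev: "eventually (\<lambda>s. norm (g (x s) - g (x t) - (s - t) *\<^sub>R c) \<le> e * \<bar>s - t\<bar>)
      (at t within S)" if "e > 0" for e
    using gx that unfolding has_vector_derivative_def has_derivative_within_alt2 by auto
  have "eventually (\<lambda>s. norm (x s - x t - (s - t) *\<^sub>R M c) \<le> \<epsilon> * \<bar>s - t\<bar>) (at t within S)"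
    if "\<epsilon> > 0" for \<epsilon>
  proof -
    \<comment> \<open>The first bound on \<open>e\<close> lets the remainder be absorbed into the left-hand side, the second makes it
      smaller than half of the final error.\<close>
    define e where "e = min (1 / (2 * K)) (\<epsilon> / (4 * K * K * C))"
    have e: "e > 0" "e * K \<le> 1 / 2" "e * K * (2 * K * C) \<le> \<epsilon> / 2"
    proof -
      show "e > 0" using K C that by (simp add: e_def)
      have "e \<le> 1 / (2 * K)" "e \<le> \<epsilon> / (4 * K * K * C)" by (simp_all add: e_def)
      then show "e * K \<le> 1 / 2" "e * K * (2 * K * C) \<le> \<epsilon> / 2"
        using K C by (simp_all add: field_simps)
    qed
    have "\<epsilon> / (2 * K) > 0" using K that by simp
    from gx_ev[OF zero_less_one] gx_ev[OF this] g_ev[OF e(1)]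
    show ?thesis
    proof eventually_elim
      case (elim s)
      define d where "d = x s - x t"
      define \<Delta> where "\<Delta> = g (x s) - g (x t)"
      have "\<Delta> = (\<Delta> - (s - t) *\<^sub>R c) + (s - t) *\<^sub>R c" by simp
      then have "norm \<Delta> \<le> norm (\<Delta> - (s - t) *\<^sub>R c) + norm ((s - t) *\<^sub>R c)"
        by (metis norm_triangle_ineq)
      also have "\<dots> \<le> C * \<bar>s - t\<bar>"
        using elim(1) by (simp add: C_def \<Delta>_def distrib_right)
      finally have \<Delta>: "norm \<Delta> \<le> C * \<bar>s - t\<bar>" .
      have rem: "norm (M (\<Delta> - L d)) \<le> e * K * norm d"
      proof -
        have "norm (M (\<Delta> - L d)) \<le> norm (\<Delta> - L d) * K" by (rule K(2))
        also have "\<dots> \<le> (e * norm d) * K"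
          using elim(3) K(1) by (intro mult_right_mono) (auto simp: \<Delta>_def d_def)
        finally show ?thesis by (simp add: mult_ac)
      qed
      have d: "d = M \<Delta> - M (\<Delta> - L d)" by (simp add: M.diff M(2))
      have "norm d \<le> norm (M \<Delta>) + norm (M (\<Delta> - L d))"
        by (subst d) (rule norm_triangle_ineq4)
      also have "\<dots> \<le> norm \<Delta> * K + 1 / 2 * norm d"
        using K(2)[of \<Delta>] rem mult_right_mono[OF e(2), of "norm d"] by simp
      also have "\<dots> \<le> (C * \<bar>s - t\<bar>) * K + 1 / 2 * norm d"
        using \<Delta> K(1) by simp
      finally have dK: "norm d \<le> 2 * K * C * \<bar>s - t\<bar>" by (simp add: mult_ac)
      have "d - (s - t) *\<^sub>R M c = M (\<Delta> - (s - t) *\<^sub>R c) - M (\<Delta> - L d)"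
        by (simp add: M.diff M.scaleR M(2))
      then have "norm (d - (s - t) *\<^sub>R M c) \<le> norm (M (\<Delta> - (s - t) *\<^sub>R c)) + norm (M (\<Delta> - L d))"
        by (simp add: norm_triangle_ineq4)
      also have "\<dots> \<le> norm (\<Delta> - (s - t) *\<^sub>R c) * K + e * K * norm d"
        using K(2) rem by (intro add_mono) auto
      also have "\<dots> \<le> (\<epsilon> / (2 * K) * \<bar>s - t\<bar>) * K + e * K * (2 * K * C * \<bar>s - t\<bar>)"
        using elim(2) K(1) e(1) dK by (intro add_mono mult_right_mono mult_left_mono) (auto simp: \<Delta>_def)
      also have "\<dots> \<le> \<epsilon> * \<bar>s - t\<bar>"
        using mult_right_mono[OF e(3), of "\<bar>s - t\<bar>"] K(1) by (simp add: field_simps)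
      finally show ?case by (simp add: d_def)
    qed
  qed
  then show ?thesis
    unfolding has_vector_derivative_def has_derivative_within_alt2
    by (auto intro: bounded_linear_scaleR_left)
qed

text \<open>The increment of \<open>D\<^sup>(\<^sup>l\<^sup>)V(s, x(s))\<close> is split into one at a moving point with varying time and one at
the fixed time \<open>t\<close>, so that the chain rule is only applied to the function \<open>V(t, \<cdot>)\<close>.\<close>

lemma total_time_derivative:
  assumes F': "\<And>s \<xi>. s \<in> {a..b} \<Longrightarrow>
      ((\<lambda>s. Dt (V s) \<xi> is) has_real_derivative F' s \<xi>) (at s within {a..b})"
    and cont: "continuous_on ({a..b} \<times> UNIV) (\<lambda>(s, \<xi>). F' s \<xi>)"
    and V: "Ck (Suc (length is)) (V t)" and t: "t \<in> {a..b}"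
    and x: "(x has_vector_derivative d) (at t within {a..b})"
  shows "((\<lambda>s. Dt (V s) (x s) is) has_real_derivative
      F' t (x t) + (\<Sum>j\<in>UNIV. Dt (V t) (x t) (j # is) * d $ j)) (at t within {a..b})"
proof -
  have "continuous (at t within {a..b}) x"
    using x by (rule has_vector_derivative_continuous)
  from time_increment_has_derivative[of a b "\<lambda>s \<xi>. Dt (V s) \<xi> is", OF F' cont this t]
  have "((\<lambda>s. Dt (V s) (x s) is - Dt (V t) (x s) is) has_real_derivative F' t (x t))
      (at t within {a..b})" by blast
  moreover have "((\<lambda>s. Dt (V t) (x s) is) has_real_derivative
      (\<Sum>j\<in>UNIV. Dt (V t) (x t) (j # is) * d $ j)) (at t within {a..b})"
    using vector_derivative_diff_chain_within[OF x has_derivative_at_withinI[OF Dt_has_derivative[OF V]]]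
    by (simp add: has_real_derivative_iff_has_vector_derivative o_def)
  ultimately show ?thesis
    using DERIV_add by fastforce
qed

section \<open>Spatial derivatives of the Hamilton-Jacobi-Bellman equation\<close>

lemma Dt_first_mode: "Dt (partial r u) \<xi> = first_mode (Dt u \<xi>) r"
  by (rule ext) (simp add: Dt_def first_mode_def)

text \<open>The index lists on both sides have the same entries.\<close>

lemma Dt_replace:
  assumes "Ck (length is) u" "p < length is"
  shows "Dt u \<xi> (r # nths is (- {p})) = Dt u \<xi> (is[p := r])"
  using Dt_mset[of "is[p := r]" u "r # nths is (- {p})" \<xi>] assms mset_replace[of p "is" r] by simp

lemma sum_split_ends:
  fixes g :: "nat \<Rightarrow> 'a::comm_monoid_add"
  assumes "3 \<le> l"
  shows "(\<Sum>i=1..l-1. g i) = g 1 + (\<Sum>i=2..l-2. g i) + g (l - 1)"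
proof -
  have I: "{1..l-1} = insert 1 (insert (l-1) {2..l-2})" "1 \<notin> insert (l-1) {2..l-2}"
    "l - 1 \<notin> {2..l-2}" using assms by auto
  show ?thesis
    unfolding I(1) using sum.insert[OF _ I(2), of g] sum.insert[OF _ I(3), of g]
    by (simp add: ac_simps)
qed

lemma sum_split_last:
  fixes g :: "nat \<Rightarrow> 'a::comm_monoid_add"
  assumes "2 \<le> l"
  shows "(\<Sum>i=1..l-1. g i) = (\<Sum>i=1..l-2. g i) + g (l - 1)"
proof -
  have I: "{1..l-1} = insert (l-1) {1..l-2}" "l - 1 \<notin> {1..l-2}" using assms by auto
  show ?thesis
    unfolding I(1) using sum.insert[OF _ I(2), of g] by (simp add: ac_simps)
qed

text \<open>Leibniz rule for \<open>\<nabla>u \<cdot> f\<close> at a critical point of \<open>u\<close>: the summand without derivative on the gradient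
vanishes, and those in which \<open>f\<close> is differentiated once or not at all are made explicit.\<close>

lemma Dt_transport:
  fixes u :: "real^'n \<Rightarrow> real"
  assumes u: "Ck (Suc (length is)) u" and f: "Ck_vec (length is) f"
    and crit: "\<And>r. Dt u \<xi> [r] = 0" and len: "2 \<le> length is"
  shows "Dt (\<lambda>\<zeta>. \<Sum>r\<in>UNIV. partial r u \<zeta> * f \<zeta> $ r) \<xi> is =
    (\<Sum>p<length is. mode_product (Dt u \<xi>) p (jacobian f (at \<xi>)) is) +
    (\<Sum>i=1..length is - 2. sym_shuffle i (length is - i)
      (contract11 i (first_mode (Dt u \<xi>)) (Dvec f \<xi>)) is) +
    (\<Sum>r\<in>UNIV. Dt u \<xi> (r # is) * f \<xi> $ r)"
proof -
  define l where "l = length is"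
  define g where "g i = sym_shuffle i (l - i) (contract11 i (first_mode (Dt u \<xi>)) (Dvec f \<xi>)) is" for i
  have l: "2 \<le> l" "l = Suc (l - 1)" using len by (auto simp: l_def)
  have "Dt (\<lambda>\<zeta>. \<Sum>r\<in>UNIV. partial r u \<zeta> * f \<zeta> $ r) \<xi> is = (\<Sum>i\<le>l. g i)"
    using Dt_sum_mult[of "is" "\<lambda>r. partial r u" "\<lambda>r \<zeta>. f \<zeta> $ r" \<xi>] u f
    by (simp add: l_def g_def Ck_vec_def Dt_first_mode Dvec_def[abs_def])
  also have "\<dots> = g 0 + ((\<Sum>i=1..l-2. g i) + g (l - 1)) + g l"
    using l sum_atMost_ends[of l g] sum_split_last[of l g] by simp
  also have "g 0 = 0"
    by (simp add: g_def sym_shuffle_0_left l_def first_mode_def crit)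
  also have "g l = (\<Sum>r\<in>UNIV. Dt u \<xi> (r # is) * f \<xi> $ r)"
    by (simp add: g_def sym_shuffle_0_right l_def first_mode_def Dvec_def Dt_def)
  also have "g (l - 1) = (\<Sum>p<l. mode_product (Dt u \<xi>) p (jacobian f (at \<xi>)) is)"
  proof -
    have "l - (l - 1) = 1" using l by simp
    then have "g (l - 1) = (\<Sum>p<l. \<Sum>r\<in>UNIV. Dt u \<xi> (r # nths is (- {p})) * Dvec f \<xi> r [is ! p])"
      using sym_shuffle_1_right[of "is" "l - 1" "first_mode (Dt u \<xi>)" "Dvec f \<xi>"] l
      by (simp add: g_def first_mode_def flip: l_def)
    also have "\<dots> = (\<Sum>p<l. mode_product (Dt u \<xi>) p (jacobian f (at \<xi>)) is)"
      unfolding mode_product_def using len Ck_SucD[OF u]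
      by (intro sum.cong refl) (simp add: l_def Dt_replace jacobian_nth[OF f])
    finally show ?thesis .
  qed
  finally show ?thesis by (simp add: g_def l_def)
qed

text \<open>The summand of the Leibniz rule with one derivative on the first gradient. The matrix occurs
transposed in it, compared with the mode product, which is why it has to be symmetric here.\<close>

lemma sym_shuffle_1_left_mode_product:
  fixes u :: "real^'n \<Rightarrow> real"
  assumes u: "Ck (length is) u" and W: "transpose W = W" and len: "length is = Suc j"
  shows "sym_shuffle 1 j (contract11 1 (first_mode (Dt u \<xi>)) (contract21 W (first_mode (Dt u \<xi>)))) is
    = (\<Sum>p<Suc j. mode_product (Dt u \<xi>) p (W ** hessian u \<xi>) is)"
proof -
  have sym: "W $ r $ s = W $ s $ r" for r s
    using W by (metis transpose_def vec_lambda_beta)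
  have "(\<Sum>r\<in>UNIV. Dt u \<xi> [r, c] * (\<Sum>b\<in>UNIV. W $ r $ b * Dt u \<xi> (b # nths is (- {p})))) =
      mode_product (Dt u \<xi>) p (W ** hessian u \<xi>) is" if "p < Suc j" "c = is ! p" for p c
  proof -
    have "(\<Sum>r\<in>UNIV. Dt u \<xi> [r, c] * (\<Sum>b\<in>UNIV. W $ r $ b * Dt u \<xi> (b # nths is (- {p})))) =
       (\<Sum>r\<in>UNIV. \<Sum>b\<in>UNIV. Dt u \<xi> [r, c] * (W $ r $ b * Dt u \<xi> (is[p := b])))"
      using that len u by (simp add: sum_distrib_left Dt_replace)
    also have "\<dots> = (\<Sum>b\<in>UNIV. \<Sum>r\<in>UNIV. Dt u \<xi> [r, c] * (W $ r $ b * Dt u \<xi> (is[p := b])))"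
      by (rule sum.swap)
    also have "\<dots> = (\<Sum>b\<in>UNIV. \<Sum>r\<in>UNIV. Dt u \<xi> (is[p := b]) * (W $ b $ r * Dt u \<xi> [r, c]))"
      by (intro sum.cong refl) (subst sym, simp)
    also have "\<dots> = mode_product (Dt u \<xi>) p (W ** hessian u \<xi>) is"
      by (simp add: mode_product_def matrix_matrix_mult_def hessian_def tensor_matrix_def
          sum_distrib_left that(2))
    finally show ?thesis .
  qed
  then show ?thesis
    by (simp add: sym_shuffle_1_left[OF len, unfolded One_nat_def] first_mode_def contract21_def)
qed

lemma sym_shuffle_1_right_mode_product:
  fixes u :: "real^'n \<Rightarrow> real"
  assumes u: "Ck (length is) u" and len: "length is = Suc j"
  shows "sym_shuffle j 1 (contract11 j (first_mode (Dt u \<xi>)) (contract21 W (first_mode (Dt u \<xi>)))) is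
    = (\<Sum>p<Suc j. mode_product (Dt u \<xi>) p (W ** hessian u \<xi>) is)"
  unfolding sym_shuffle_1_right[OF len] mode_product_def using u len
  by (intro sum.cong refl)
     (simp add: first_mode_def contract21_def Dt_replace matrix_matrix_mult_def hessian_def tensor_matrix_def)


lemma Dt_gradient_quadratic:
  fixes u :: "real^'n \<Rightarrow> real"
  assumes u: "Ck (Suc (length is)) u" and W: "transpose W = W"
    and crit: "\<And>r. Dt u \<xi> [r] = 0" and len: "1 \<le> length is"
  shows "Dt (\<lambda>\<zeta>. \<Sum>r\<in>UNIV. partial r u \<zeta> * (\<Sum>s\<in>UNIV. W $ r $ s * partial s u \<zeta>)) \<xi> is =
    (\<Sum>i=1..length is - 1. sym_shuffle i (length is - i)
      (contract11 i (first_mode (Dt u \<xi>)) (contract21 W (first_mode (Dt u \<xi>)))) is)"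
proof -
  have "partial s u \<xi> = 0" for s
    using crit[of s] by (simp add: Dt_def)
  then show ?thesis
    using Dt_quadratic[of "is" "\<lambda>r. partial r u" W \<xi>] u W len
    by (simp add: Dt_first_mode)
qed

lemma Ck_residual: "Ck k u \<Longrightarrow> Ck k (\<lambda>\<zeta>. c - u \<zeta>)"
  using Ck_add[OF Ck_const[of k c] Ck_mult[OF Ck_const[of k "-1"]]] by simp

lemma Dt_residual:
  assumes "Ck (length is) u" "is \<noteq> []"
  shows "Dt (\<lambda>\<zeta>. c - u \<zeta>) \<xi> is = - Dt u \<xi> is"
proof -
  have "Dt (\<lambda>\<zeta>. c + (-1) * u \<zeta>) \<xi> is = - Dt u \<xi> is"
    unfolding Dt_def using assms
    by (subst iter_partial_add) (simp_all only: Ck_const Ck_mult iter_partial_const iter_partial_cmult if_False)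
  then show ?thesis by simp
qed

text \<open>Every derivative of the residual \<open>c - h\<close> of positive order is a derivative of \<open>-h\<close>. Both factors are differentiated
in the middle summands, so the signs cancel there.\<close>

lemma Dt_output_quadratic:
  fixes h :: "real^'n \<Rightarrow> real^'p"
  assumes h: "Ck_vec (length is) h" and Q: "transpose Q = Q" and len: "1 \<le> length is"
  shows "Dt (\<lambda>\<zeta>. \<Sum>r\<in>UNIV. (c $ r - h \<zeta> $ r) * (\<Sum>s\<in>UNIV. Q $ r $ s * (c $ s - h \<zeta> $ s))) \<xi> is =
    - 2 * contract11 (length is) (Dvec h \<xi>) (vec_tensor (Q *v (c - h \<xi>))) is +
    (\<Sum>i=1..length is - 1. sym_shuffle i (length is - i)
      (contract11 i (Dvec h \<xi>) (contract21 Q (Dvec h \<xi>))) is)"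
proof -
  define w where "w = (\<lambda>r \<zeta>. c $ r - h \<zeta> $ r)"
  have w: "Ck (length is) (w r)" for r
    using h by (auto simp: w_def Ck_vec_def intro: Ck_residual)
  have Dw: "Dt (w r) \<xi> js = - Dvec h \<xi> r js" if "length js \<le> length is" "js \<noteq> []" for r js
    unfolding w_def Dvec_def using h that Ck_mono
    by (intro Dt_residual) (auto simp: Ck_vec_def)
  have "(\<Sum>r\<in>UNIV. Dt (w r) \<xi> is * (\<Sum>s\<in>UNIV. Q $ r $ s * w s \<xi>)) =
      - contract11 (length is) (Dvec h \<xi>) (vec_tensor (Q *v (c - h \<xi>))) is"
    using len
    by (subst Dw) (auto simp: contract11_def vec_tensor_def matrix_vector_mult_def w_def
        simp flip: sum_negf)
  moreover have "sym_shuffle i (length is - i)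
      (contract11 i (\<lambda>r. Dt (w r) \<xi>) (contract21 Q (\<lambda>r. Dt (w r) \<xi>))) is =
    sym_shuffle i (length is - i) (contract11 i (Dvec h \<xi>) (contract21 Q (Dvec h \<xi>))) is"
    if "i \<in> {1..length is - 1}" for i
  proof (rule sym_shuffle_contract11_cong)
    fix js ks :: "'n list" and r assume "length js = i" "length ks = length is - i"
    then have "js \<noteq> []" "ks \<noteq> []" "length js \<le> length is" "length ks \<le> length is"
      using that by auto
    then show "Dt (w r) \<xi> js * contract21 Q (\<lambda>r. Dt (w r) \<xi>) r ks =
        Dvec h \<xi> r js * contract21 Q (Dvec h \<xi>) r ks"
      by (simp add: Dw contract21_def sum_negf)
  qed (use that in auto)
  ultimately show ?thesis
    using Dt_quadratic[of "is" w Q \<xi>, OF w Q len] by (simp add: w_def)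
qed

definition HJB_rhs ::
    "(real^'n \<Rightarrow> real^'n) \<Rightarrow> (real^'n \<Rightarrow> real^'p) \<Rightarrow> real^'m^'n \<Rightarrow> real^'m^'m \<Rightarrow> real^'p^'p \<Rightarrow>
      real^'p \<Rightarrow> (real^'n \<Rightarrow> real) \<Rightarrow> real^'n \<Rightarrow> real" where
  "HJB_rhs f h G R Q c u \<zeta> = - (gradient u \<zeta> \<bullet> f \<zeta>)
     - 1/2 * sqnorm (matrix_inv R) (transpose G *v gradient u \<zeta>) + 1/2 * sqnorm Q (c - h \<zeta>)"

lemma sqnorm_sum: "sqnorm A z = (\<Sum>r\<in>UNIV. z $ r * (\<Sum>s\<in>UNIV. A $ r $ s * z $ s))"
  by (simp add: sqnorm_def inner_vec_def matrix_vector_mult_def)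

lemma sqnorm_transpose: "sqnorm A (transpose G *v z) = sqnorm (G ** A ** transpose G) z"
proof -
  have "(transpose G *v z) \<bullet> y = z \<bullet> (G *v y)" for y
    by (metis dot_lmul_matrix vector_transpose_matrix transpose_transpose)
  then show ?thesis
    by (simp only: sqnorm_def matrix_vector_mul_assoc matrix_mul_assoc)
qed

text \<open>With \<open>W = G R\<^sup>-\<^sup>1 G\<^sup>T\<close> all three terms are sums of products, to which the Leibniz rule applies.\<close>

lemma HJB_rhs_sums:
  "HJB_rhs f h G R Q c u = (\<lambda>\<zeta>. (-1) * (\<Sum>r\<in>UNIV. partial r u \<zeta> * f \<zeta> $ r)
    + ((-1/2) * (\<Sum>r\<in>UNIV. partial r u \<zeta> *
          (\<Sum>s\<in>UNIV. (G ** matrix_inv R ** transpose G) $ r $ s * partial s u \<zeta>))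
    + 1/2 * (\<Sum>r\<in>UNIV. (c $ r - h \<zeta> $ r) * (\<Sum>s\<in>UNIV. Q $ r $ s * (c $ s - h \<zeta> $ s)))))"
  unfolding HJB_rhs_def sqnorm_transpose
  by (rule ext) (simp add: sqnorm_sum inner_vec_def gradient_def Dt_def)

lemma Dt_HJB_rhs:
  fixes u :: "real^'n \<Rightarrow> real"
  assumes u: "Ck (Suc (length is)) u" and f: "Ck_vec (length is) f" and h: "Ck_vec (length is) h"
    and W: "W = G ** matrix_inv R ** transpose G" "transpose W = W" and Q: "transpose Q = Q"
    and crit: "\<And>r. Dt u \<xi> [r] = 0" and len: "1 \<le> length is"
  shows "Dt (HJB_rhs f h G R Q c u) \<xi> is =
    - Dt (\<lambda>\<zeta>. \<Sum>r\<in>UNIV. partial r u \<zeta> * f \<zeta> $ r) \<xi> is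
    - 1/2 * (\<Sum>i=1..length is - 1. sym_shuffle i (length is - i)
        (contract11 i (first_mode (Dt u \<xi>)) (contract21 W (first_mode (Dt u \<xi>)))) is)
    - contract11 (length is) (Dvec h \<xi>) (vec_tensor (Q *v (c - h \<xi>))) is
    + 1/2 * (\<Sum>i=1..length is - 1. sym_shuffle i (length is - i)
        (contract11 i (Dvec h \<xi>) (contract21 Q (Dvec h \<xi>))) is)"
proof -
  define A where "A \<zeta> = (\<Sum>r\<in>UNIV. partial r u \<zeta> * f \<zeta> $ r)" for \<zeta>
  define B where "B \<zeta> = (\<Sum>r\<in>UNIV. partial r u \<zeta> * (\<Sum>s\<in>UNIV. W $ r $ s * partial s u \<zeta>))" for \<zeta>
  define C where "C \<zeta> = (\<Sum>r\<in>UNIV. (c $ r - h \<zeta> $ r) * (\<Sum>s\<in>UNIV. Q $ r $ s * (c $ s - h \<zeta> $ s)))" for \<zeta>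
  have Ck: "Ck (length is) A" "Ck (length is) B" "Ck (length is) C"
    unfolding A_def B_def C_def using u f h
    by (auto simp: Ck_vec_def intro!: Ck_sum Ck_mult Ck_residual)
  have "Dt (HJB_rhs f h G R Q c u) \<xi> is = Dt (\<lambda>\<zeta>. (-1) * A \<zeta> + ((-1/2) * B \<zeta> + 1/2 * C \<zeta>)) \<xi> is"
    by (simp only: HJB_rhs_sums A_def B_def C_def W(1))
  also have "\<dots> = (-1) * Dt A \<xi> is + ((-1/2) * Dt B \<xi> is + 1/2 * Dt C \<xi> is)"
    unfolding Dt_def using Ck
    by (simp only: iter_partial_add iter_partial_cmult Ck_add Ck_mult Ck_const)
  finally show ?thesis
    using Dt_gradient_quadratic[OF u W(2) crit len, folded B_def]
      Dt_output_quadratic[OF h Q len, of c \<xi>, folded C_def] unfolding A_def by simp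
qed

text \<open>The equation of first order, from which the velocity of the observer is obtained.\<close>

lemma Dt_HJB_rhs_order_1:
  fixes u :: "real^'n \<Rightarrow> real"
  assumes u: "Ck 2 u" and f: "Ck_vec 1 f" and h: "Ck_vec 1 h"
    and W: "W = G ** matrix_inv R ** transpose G" "transpose W = W" and Q: "transpose Q = Q"
    and crit: "\<And>r. Dt u \<xi> [r] = 0"
  shows "Dt (HJB_rhs f h G R Q c u) \<xi> [i] =
    - (hessian u \<xi> *v f \<xi> + transpose (jacobian h (at \<xi>)) *v (Q *v (c - h \<xi>))) $ i"
proof -
  have u': "Ck (Suc (length [i])) u" using u by (simp add: numeral_2_eq_2)
  have "Dt u \<xi> [r, i] = hessian u \<xi> $ i $ r" for r
    using Dt_mset[of "[r, i]" u "[i, r]" \<xi>] u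
    by (simp add: hessian_def tensor_matrix_def numeral_2_eq_2)
  moreover have "Dt (\<lambda>\<zeta>. \<Sum>r\<in>UNIV. partial r u \<zeta> * f \<zeta> $ r) \<xi> [i] =
      (\<Sum>r\<in>UNIV. Dt u \<xi> [r, i] * f \<xi> $ r)"
  proof -
    have "{..1::nat} = {0, 1}" by auto
    then show ?thesis
      using Dt_sum_mult[of "[i]" "\<lambda>r. partial r u" "\<lambda>r \<zeta>. f \<zeta> $ r" \<xi>] u' f
        sym_shuffle_0_left[of "[i]" 1 "first_mode (Dt u \<xi>)" "Dvec f \<xi>"]
        sym_shuffle_0_right[of "[i]" 1 "first_mode (Dt u \<xi>)" "Dvec f \<xi>"]
      by (simp add: Ck_vec_def Dt_first_mode Dvec_def[abs_def])
         (simp add: first_mode_def Dt_def crit[unfolded Dt_def, simplified])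
  qed
  moreover have "contract11 1 (Dvec h \<xi>) (vec_tensor (Q *v (c - h \<xi>))) [i] =
      (transpose (jacobian h (at \<xi>)) *v (Q *v (c - h \<xi>))) $ i"
  proof -
    have "(transpose (jacobian h (at \<xi>)) *v z) $ i = (\<Sum>r\<in>UNIV. Dvec h \<xi> r [i] * z $ r)" for z
      by (simp add: matrix_vector_mult_def transpose_def jacobian_nth[OF h])
    then show ?thesis by (simp add: contract11_def vec_tensor_def)
  qed
  ultimately show ?thesis
    using Dt_HJB_rhs[OF u' _ _ W Q crit, of f h c] f h
    by (simp add: matrix_vector_mult_def[of "hessian _ _"])
qed

text \<open>For \<open>l \<ge> 3\<close> the summands \<open>i = 1\<close> and \<open>i = l - 1\<close> of the quadratic term are distinct and cancel the
factor one half; for \<open>l = 2\<close> there is only one such summand and the factor stays.\<close>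

lemma Dt_HJB_rhs_order_ge_2:
  fixes u :: "real^'n \<Rightarrow> real"
  assumes u: "Ck (Suc l) u" and f: "Ck_vec l f" and h: "Ck_vec l h"
    and W: "W = G ** matrix_inv R ** transpose G" "transpose W = W" and Q: "transpose Q = Q"
    and crit: "\<And>r. Dt u \<xi> [r] = 0" and l: "length is = l" "2 \<le> l"
  shows "Dt (HJB_rhs f h G R Q c u) \<xi> is =
    - (\<Sum>p<l. mode_product (Dt u \<xi>) p (jacobian f (at \<xi>)) is)
    - (\<Sum>p<l. mode_product (Dt u \<xi>) p (W ** hessian u \<xi>) is) / (if l = 2 then 2 else 1)
    - Rtensor f h G R Q c \<xi> (\<lambda>_. Dt u \<xi>) l is
    - (\<Sum>r\<in>UNIV. Dt u \<xi> (r # is) * f \<xi> $ r)"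
proof -
  define g where "g i = sym_shuffle i (l - i)
    (contract11 i (first_mode (Dt u \<xi>)) (contract21 W (first_mode (Dt u \<xi>)))) is" for i
  have ul: "Ck (length is) u" using u l Ck_SucD by blast
  have lS: "length is = Suc (l - 1)" using l by simp
  have ends: "g 1 = (\<Sum>p<l. mode_product (Dt u \<xi>) p (W ** hessian u \<xi>) is)"
      "g (l - 1) = (\<Sum>p<l. mode_product (Dt u \<xi>) p (W ** hessian u \<xi>) is)"
  proof -
    have "l - (l - 1) = 1" "Suc (l - 1) = l" using l by auto
    then show "g 1 = (\<Sum>p<l. mode_product (Dt u \<xi>) p (W ** hessian u \<xi>) is)"
      "g (l - 1) = (\<Sum>p<l. mode_product (Dt u \<xi>) p (W ** hessian u \<xi>) is)"
      using sym_shuffle_1_left_mode_product[OF ul W(2) lS, of \<xi>] sym_shuffle_1_right_mode_product[OF ul lS, of \<xi> W]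
      by (simp_all only: g_def)
  qed
  have "1/2 * (\<Sum>i=1..l-1. g i) = 1/2 * (\<Sum>i=2..l-2. g i) +
      (\<Sum>p<l. mode_product (Dt u \<xi>) p (W ** hessian u \<xi>) is) / (if l = 2 then 2 else 1)"
  proof (cases "l = 2")
    case True
    with ends show ?thesis by simp
  next
    case False
    with l have "3 \<le> l" by simp
    with ends False show ?thesis by (simp only: sum_split_ends) simp
  qed
  moreover have "Dt (HJB_rhs f h G R Q c u) \<xi> is =
    - Dt (\<lambda>\<zeta>. \<Sum>r\<in>UNIV. partial r u \<zeta> * f \<zeta> $ r) \<xi> is - 1/2 * (\<Sum>i=1..l-1. g i)
    - contract11 l (Dvec h \<xi>) (vec_tensor (Q *v (c - h \<xi>))) is
    + 1/2 * (\<Sum>i=1..l-1. sym_shuffle i (l-i) (contract11 i (Dvec h \<xi>) (contract21 Q (Dvec h \<xi>))) is)"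
    using Dt_HJB_rhs[of "is" u f h W G R Q \<xi> c] assms(1-3) l by (simp add: W(2) Q crit g_def flip: W(1))
  moreover have "Dt (\<lambda>\<zeta>. \<Sum>r\<in>UNIV. partial r u \<zeta> * f \<zeta> $ r) \<xi> is =
    (\<Sum>p<l. mode_product (Dt u \<xi>) p (jacobian f (at \<xi>)) is) +
    (\<Sum>i=1..l-2. sym_shuffle i (l-i) (contract11 i (first_mode (Dt u \<xi>)) (Dvec f \<xi>)) is) +
    (\<Sum>r\<in>UNIV. Dt u \<xi> (r # is) * f \<xi> $ r)"
    using Dt_transport[of "is" u f \<xi>] assms(1,2) l by (simp add: crit)
  moreover have "Rtensor f h G R Q c \<xi> (\<lambda>_. Dt u \<xi>) l is =
    (\<Sum>i=1..l-2. sym_shuffle i (l-i) (contract11 i (first_mode (Dt u \<xi>)) (Dvec f \<xi>)) is)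
    + 1/2 * (\<Sum>i=2..l-2. g i)
    + contract11 l (Dvec h \<xi>) (vec_tensor (Q *v (c - h \<xi>))) is
    - 1/2 * (\<Sum>i=1..l-1. sym_shuffle i (l-i) (contract11 i (Dvec h \<xi>) (contract21 Q (Dvec h \<xi>))) is)"
    by (simp only: Rtensor_def g_def W(1))
  ultimately show ?thesis by linarith
qed

lemma hessian_symmetric: "Ck 2 u \<Longrightarrow> transpose (hessian u \<xi>) = hessian u \<xi>"
  using Dt_mset[of "[i, j]" u "[j, i]" \<xi> for i j]
  by (simp add: vec_eq_iff transpose_def hessian_def tensor_matrix_def numeral_2_eq_2)

lemma sum_mode_product_order_2:
  "(\<Sum>p<2. mode_product A p C [i, j]) =
    (transpose C ** tensor_matrix A + tensor_matrix A ** C) $ i $ j"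
  by (simp add: numeral_2_eq_2 mode_product_def matrix_matrix_mult_def transpose_def
      tensor_matrix_def mult.commute)

lemma mode_product_add:
  "mode_product A p (B + C) is = mode_product A p B is + mode_product A p C is"
  by (simp add: mode_product_def sum.distrib distrib_left)

section \<open>Initial data, minimizers and matrices\<close>

lemma coordinate_has_derivative:
  fixes \<xi> :: "real^'n"
  shows "((\<lambda>\<zeta>. \<zeta> $ r - c) has_derivative (\<lambda>v. v $ r)) (at \<xi>)"
proof -
  have "((\<lambda>\<zeta>. \<zeta> $ r - c) has_derivative (\<lambda>v. v $ r - 0)) (at \<xi>)"
    by (intro has_derivative_diff has_derivative_const bounded_linear_imp_has_derivative
        bounded_linear_vec_nth)
  then show ?thesis by simp
qed

lemma partial_coordinate:
  "partial j (\<lambda>\<zeta>::real^'n. \<zeta> $ r - c) = (\<lambda>_. if j = r then 1 else 0)"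
  by (rule ext) (auto simp: partial_has_derivative[OF coordinate_has_derivative] axis_def)

lemma Ck_coordinate: "Ck k (\<lambda>\<zeta>::real^'n. \<zeta> $ r - c)"
proof (cases k)
  case 0
  then show ?thesis by (auto intro!: continuous_intros)
next
  case (Suc m)
  then show ?thesis
    using differentiableI[OF coordinate_has_derivative] by (auto simp: partial_coordinate)
qed

lemma Dt_coordinate:
  "Dt (\<lambda>\<zeta>. \<zeta> $ r - x0 $ r) x0 js = (if js = [r] then 1 else 0)"
  by (cases js) (auto simp: Dt_def partial_coordinate iter_partial_const)

text \<open>Each of the two linear factors vanishes at the centre and is killed by two derivatives, so exactly one derivative
has to fall on each factor.\<close>

lemma Dt_centered_quadratic:
  fixes x0 :: "real^'n"
  assumes "transpose \<Gamma> = \<Gamma>" "2 \<le> length is"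
  shows "Dt (\<lambda>\<zeta>. 1/2 * sqnorm \<Gamma> (\<zeta> - x0)) x0 is = (if length is = 2 then \<Gamma> $ (is ! 0) $ (is ! 1) else 0)"
proof -
  define w where "w r \<zeta> = \<zeta> $ r - x0 $ r" for r and \<zeta> :: "real^'n"
  define D where "D r = Dt (w r) x0" for r
  have w: "Ck k (w r)" for k r
    unfolding w_def by (rule Ck_coordinate)
  have D: "D r js = (if js = [r] then 1 else 0)" for r js
    unfolding D_def w_def by (rule Dt_coordinate)
  have "Dt (\<lambda>\<zeta>. 1/2 * sqnorm \<Gamma> (\<zeta> - x0)) x0 is =
      1/2 * Dt (\<lambda>\<zeta>. \<Sum>r\<in>UNIV. w r \<zeta> * (\<Sum>s\<in>UNIV. \<Gamma> $ r $ s * w s \<zeta>)) x0 is"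
    unfolding Dt_def sqnorm_sum vector_minus_component w_def[symmetric]
    by (intro iter_partial_cmult Ck_sum Ck_mult w) auto
  also have "\<dots> = 1/2 * (\<Sum>i=1..length is - 1. sym_shuffle i (length is - i)
      (contract11 i D (contract21 \<Gamma> D)) is)"
    using Dt_quadratic[of "is" w \<Gamma> x0, folded D_def[abs_def]] w assms by (simp add: w_def)
  also have "\<dots> = (if length is = 2 then \<Gamma> $ (is ! 0) $ (is ! 1) else 0)"
  proof (cases "length is = 2")
    case True
    then obtain a b where ab: "is = [a, b]"
      by (auto simp: numeral_2_eq_2 length_Suc_conv)
    have sym: "\<Gamma> $ b $ a = \<Gamma> $ a $ b"
      using assms(1) by (metis transpose_def vec_lambda_beta)
    have "sym_shuffle 1 1 (contract11 1 D (contract21 \<Gamma> D)) [a, b] = \<Gamma> $ a $ b + \<Gamma> $ b $ a"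
      using sym_shuffle_1_left[of "[a, b]" 1 D "contract21 \<Gamma> D"]
      by (simp add: D contract21_def nths_Cons if_distrib[of "\<lambda>x. x * _"] if_distrib[of "\<lambda>x. _ * x"] cong: if_cong)
    then show ?thesis using ab sym by simp
  next
    case False
    have "sym_shuffle i (length is - i) (contract11 i D (contract21 \<Gamma> D)) is = 0"
      if "i \<in> {1..length is - 1}" for i
    proof -
      have "sym_shuffle i (length is - i) (contract11 i D (contract21 \<Gamma> D)) is =
          sym_shuffle i (length is - i) (contract11 i (\<lambda>(_::'n) _. 0) (\<lambda>_ _. 0)) is"
      proof (rule sym_shuffle_contract11_cong)
        fix js ks :: "'n list" and r
        assume l: "length js = i" "length ks = length is - i"
        have "i \<noteq> 1 \<or> length is - i \<noteq> 1" using False assms(2) that by auto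
        then have "D r js = 0 \<or> (\<forall>s. D s ks = 0)" using l by (auto simp: D)
        then show "D r js * contract21 \<Gamma> D r ks = 0 * 0"
          by (auto simp: contract21_def)
      qed (use that in auto)
      then show ?thesis by (simp add: sym_shuffle_def contract11_def)
    qed
    with False show ?thesis by simp
  qed
  finally show ?thesis .
qed

lemma spd_invertible:
  assumes "spd A" shows "invertible A"
proof -
  have "x = 0" if "A *v x = 0" for x
    using assms that unfolding spd_def by (metis inner_zero_right less_irrefl)
  then show ?thesis
    unfolding invertible_left_inverse by (simp add: matrix_left_invertible_ker)
qed

lemma matrix_inv_inverse:
  assumes "invertible A" 
  shows "A ** matrix_inv A = mat 1" "matrix_inv A ** A = mat 1"
  using assms unfolding invertible_def matrix_inv_def by (metis (mono_tags, lifting) someI_ex)+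

lemma transpose_matrix_inv_symmetric:
  fixes A :: "real^'n^'n"
  assumes "transpose A = A" "invertible A"
  shows "transpose (matrix_inv A) = matrix_inv A"
proof -
  have "transpose (matrix_inv A) ** A = mat 1"
    using matrix_inv_inverse(1)[OF assms(2)] assms(1) matrix_transpose_mul[of A "matrix_inv A"]
    by simp
  then show ?thesis
    using matrix_inv_inverse(1)[OF assms(2)]
    by (metis matrix_mul_assoc matrix_mul_lid matrix_mul_rid)
qed

lemma tensor_matrix_nth: "tensor_matrix A $ i $ j = A [i, j]"
  by (simp add: tensor_matrix_def)

lemma Dt_minimum:
  fixes u :: "real^'n \<Rightarrow> real"
  assumes "Ck 1 u" "\<And>\<zeta>. u \<xi> \<le> u \<zeta>"
  shows "Dt u \<xi> [r] = 0"
proof -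
  obtain u' where u': "(u has_derivative u') (at \<xi>)"
    using Ck_differentiable[OF assms(1)] by (auto simp: differentiable_def)
  then have "u' = (\<lambda>v. 0)"
    using differential_zero_maxmin[of \<xi> UNIV u u'] assms(2) by auto
  then show ?thesis
    using partial_has_derivative[OF u'] by (simp add: Dt_def)
qed

lemma gradient_has_derivative:
  fixes u :: "real^'n \<Rightarrow> real"
  assumes "Ck 2 u"
  shows "(gradient u has_derivative (\<lambda>v. hessian u \<xi> *v v)) (at \<xi>)"
proof -
  have g: "(\<lambda>\<zeta>. gradient u \<zeta> $ i) = partial i u" for i
    by (simp add: gradient_def Dt_def)
  have "Ck_vec 1 (gradient u)"
    using assms by (simp add: Ck_vec_def g numeral_2_eq_2)
  from Ck_vec_has_derivative[OF this, of \<xi>] show ?thesis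
    by (simp add: g matrix_vector_mult_def hessian_def tensor_matrix_def Dt_def)
qed

section \<open>The observer equations\<close>

theorem theorem3p3:
  fixes f :: "real^'n \<Rightarrow> real^'n" and h :: "real^'n \<Rightarrow> real^'p" and G :: "real^'m^'n"
    and x0 :: "real^'n" and \<Gamma> :: "real^'n^'n" and R :: "real^'m^'m" and Q :: "real^'p^'p"
    and T :: real and k :: nat and y :: "real \<Rightarrow> real^'p" and V :: "real \<Rightarrow> real^'n \<Rightarrow> real"
  assumes T_pos: "T > 0" and k_ge: "k \<ge> 3"
    and spd_Gamma: "spd \<Gamma>" and spd_R: "spd R" and spd_Q: "spd Q"
    and y_measured: "measured_output f h G x0 T y"
    and V_value: "value_function f h G x0 \<Gamma> R Q y T V"
    and V_HJB: "HJB f h G x0 \<Gamma> R Q y T V"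
    and A1: "Ck_vec k f" "Ck_vec k h"
    and A2: "\<And>t. t \<in> {0..T} \<Longrightarrow> Ck (k+1) (V t)"
    and A3_diff: "\<And>is t \<xi>. length is \<le> k \<Longrightarrow> t \<in> {0..T} \<Longrightarrow>
        (\<lambda>s. Dt (V s) \<xi> is) differentiable (at t within {0..T})"
    and A3_cont: "\<And>is. length is \<le> k \<Longrightarrow>
        continuous_on ({0..T} \<times> UNIV) (\<lambda>(t, \<xi>). time_deriv T (\<lambda>s. Dt (V s) \<xi> is) t)"
    and A3_exchange: "\<And>is t. length is \<le> k \<Longrightarrow> t \<in> {0..T} \<Longrightarrow>
        time_deriv T (\<lambda>s. Dt (V s) (mortensen_observer V t) is) t =
        Dt (\<lambda>\<xi>. time_deriv T (\<lambda>s. V s \<xi>) t) (mortensen_observer V t) is"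
    and B1_unique: "\<And>t. t \<in> {0..T} \<Longrightarrow> \<exists>!\<xi>. is_arg_min (V t) (\<lambda>_. True) \<xi>"
    and B1_cont: "continuous_on {0..T} (mortensen_observer V)"
    and B2: "\<And>t. t \<in> {0..T} \<Longrightarrow> invertible (hessian (V t) (mortensen_observer V t))"
    and C: "\<And>t is. t \<in> {0..T} \<Longrightarrow> length is = k + 1 \<Longrightarrow>
        Dt (V t) (mortensen_observer V t) is = 0"
  shows "\<exists>P. observer_system f h G x0 \<Gamma> R Q y T k (mortensen_observer V) P"
proof -
  define x where "x = mortensen_observer V"
  define P :: "nat \<Rightarrow> real \<Rightarrow> 'n list \<Rightarrow> real" where "P j t = Dt (V t) (x t)" for j t
  define W where "W = G ** matrix_inv R ** transpose G"
  define w where "w t = gain h Q (y t) (x t) (\<lambda>j. P j t)" for t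
  have k: "1 \<le> k" "2 \<le> k" "3 \<le> k" using k_ge by auto
  have Q: "transpose Q = Q" and \<Gamma>: "transpose \<Gamma> = \<Gamma>" using spd_Q spd_Gamma by (auto simp: spd_def)
  have W: "transpose W = W"
    using transpose_matrix_inv_symmetric[OF _ spd_invertible[OF spd_R]] spd_R
    by (simp add: W_def spd_def matrix_transpose_mul matrix_mul_assoc)
  have fC: "Ck_vec l f" and hC: "Ck_vec l h" if "l \<le> k" for l
    using A1 that by (auto simp: Ck_vec_def intro: Ck_mono)
  have VC: "Ck l (V t)" if "t \<in> {0..T}" "l \<le> k + 1" for l t
    using Ck_mono[OF A2] that by blast

  have is_min: "is_arg_min (V t) (\<lambda>_. True) (x t)" if "t \<in> {0..T}" for t
    using B1_unique[OF that] unfolding x_def mortensen_observer_def arg_min_def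
    by (metis (no_types, lifting) someI_ex)
  have crit: "Dt (V t) (x t) [r] = 0" if "t \<in> {0..T}" for t r
    by (rule Dt_minimum[OF VC[OF that]]) (use is_min[OF that] in \<open>simp_all add: is_arg_min_linorder\<close>)

  \<comment> \<open>Time derivatives on an interval of positive length are unique, also one-sided ones.\<close>
  have time_deriv_rhs: "time_deriv T (\<lambda>s. V s \<xi>) t = HJB_rhs f h G R Q (y t) (V t) \<xi>"
    if "t \<in> {0..T}" for t \<xi>
    unfolding time_deriv_def HJB_rhs_def
    using V_HJB that T_pos
    by (intro vector_derivative_within_closed_interval)
       (auto simp: HJB_def has_real_derivative_iff_has_vector_derivative)
  have time_deriv_works: "((\<lambda>s. Dt (V s) \<xi> is) has_real_derivative
      time_deriv T (\<lambda>s. Dt (V s) \<xi> is) t) (at t within {0..T})"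
    if "t \<in> {0..T}" "length is \<le> k" for t \<xi> "is"
    using A3_diff[OF that(2,1)]
    by (simp add: time_deriv_def has_real_derivative_iff_has_vector_derivative vector_derivative_works)
  have time_deriv_x: "time_deriv T (\<lambda>s. Dt (V s) (x t) is) t =
      Dt (HJB_rhs f h G R Q (y t) (V t)) (x t) is"
    if "t \<in> {0..T}" "length is \<le> k" for t "is"
    using A3_exchange[OF that(2,1)] that by (simp add: x_def time_deriv_rhs)

  have x': "(x has_vector_derivative f (x t) + w t) (at t within {0..T})" if t: "t \<in> {0..T}" for t
  proof -
    let ?H = "hessian (V t) (x t)"
    let ?b = "transpose (jacobian h (at (x t))) *v (Q *v (y t - h (x t)))"
    have contx: "continuous (at t within {0..T}) x"
      using B1_cont t by (simp add: x_def continuous_on_eq_continuous_within)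
    \<comment> \<open>The gradient vanishes along the curve at every time, so freezing its time argument at \<open>t\<close> gives
      minus the increment in time.\<close>
    have gx': "((\<lambda>s. gradient (V t) (x s)) has_vector_derivative ?H *v f (x t) + ?b) (at t within {0..T})"
    proof (rule has_vector_derivative_vecI)
      fix i
      have "((\<lambda>s. Dt (V s) (x s) [i] - Dt (V t) (x s) [i]) has_real_derivative
          time_deriv T (\<lambda>s. Dt (V s) (x t) [i]) t) (at t within {0..T})"
        using time_deriv_works A3_cont[of "[i]"] contx t k
        by (intro time_increment_has_derivative) auto
      then have "((\<lambda>s. - (Dt (V s) (x s) [i] - Dt (V t) (x s) [i])) has_real_derivative
          - time_deriv T (\<lambda>s. Dt (V s) (x t) [i]) t) (at t within {0..T})"
        by (rule DERIV_minus)
      moreover have "- time_deriv T (\<lambda>s. Dt (V s) (x t) [i]) t = (?H *v f (x t) + ?b) $ i"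
        using time_deriv_x[OF t, of "[i]"] k
          Dt_HJB_rhs_order_1[OF VC[OF t] fC hC W_def W Q crit[OF t], of "y t" i] by simp
      ultimately have "((\<lambda>s. - (Dt (V s) (x s) [i] - Dt (V t) (x s) [i])) has_real_derivative
          (?H *v f (x t) + ?b) $ i) (at t within {0..T})"
        by simp
      then have "((\<lambda>s. gradient (V t) (x s) $ i) has_real_derivative
          (?H *v f (x t) + ?b) $ i) (at t within {0..T})"
        by (rule has_field_derivative_transform_within[OF _ zero_less_one t])
           (simp add: gradient_def crit)
      then show "((\<lambda>s. gradient (V t) (x s) $ i) has_vector_derivative
          (?H *v f (x t) + ?b) $ i) (at t within {0..T})"
        by (simp add: has_real_derivative_iff_has_vector_derivative)
    qed
    have g': "(gradient (V t) has_derivative (\<lambda>v. ?H *v v)) (at (x t))"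
      by (rule gradient_has_derivative[OF VC[OF t]]) (use k in simp)
    have inv: "matrix_inv ?H *v (?H *v v) = v" for v
      using matrix_inv_inverse(2)[OF B2[OF t]] by (simp add: x_def matrix_vector_mul_assoc)
    have "(x has_vector_derivative matrix_inv ?H *v (?H *v f (x t) + ?b)) (at t within {0..T})"
      by (rule has_vector_derivative_cancel_left[OF g' matrix_vector_mul_bounded_linear inv gx' contx])
    also have "matrix_inv ?H *v (?H *v f (x t) + ?b) = f (x t) + matrix_inv ?H *v ?b"
      by (simp only: matrix_vector_right_distrib inv)
    also have "matrix_inv ?H *v ?b = w t"
      by (simp only: w_def gain_def P_def hessian_def)
    finally show ?thesis .
  qed

  have P': "((\<lambda>s. P l s is) has_real_derivative
      - (\<Sum>p<l. mode_product (P l t) p (jacobian f (at (x t))) is)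
      - (\<Sum>p<l. mode_product (P l t) p (W ** tensor_matrix (P 2 t)) is) / (if l = 2 then 2 else 1)
      - Rtensor f h G R Q (y t) (x t) (\<lambda>j. P j t) l is
      + contract11 l (first_mode (P (l + 1) t)) (vec_tensor (w t)) is) (at t within {0..T})"
    if t: "t \<in> {0..T}" and l: "2 \<le> l" "l \<le> k" "length is = l" for t l "is"
  proof -
    have "((\<lambda>s. Dt (V s) (x s) is) has_real_derivative time_deriv T (\<lambda>s. Dt (V s) (x t) is) t
        + (\<Sum>j\<in>UNIV. Dt (V t) (x t) (j # is) * (f (x t) + w t) $ j)) (at t within {0..T})"
      using time_deriv_works A3_cont[of "is"] VC x' t l
      by (intro total_time_derivative) (auto simp del: Ck.simps)
    moreover have "time_deriv T (\<lambda>s. Dt (V s) (x t) is) t =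
        - (\<Sum>p<l. mode_product (P l t) p (jacobian f (at (x t))) is)
        - (\<Sum>p<l. mode_product (P l t) p (W ** tensor_matrix (P 2 t)) is) / (if l = 2 then 2 else 1)
        - Rtensor f h G R Q (y t) (x t) (\<lambda>j. P j t) l is
        - (\<Sum>r\<in>UNIV. Dt (V t) (x t) (r # is) * f (x t) $ r)"
      unfolding P_def hessian_def[symmetric]
      using Dt_HJB_rhs_order_ge_2[OF VC[OF t] fC hC W_def W Q crit[OF t] l(3,1), of "y t"]
        time_deriv_x[OF t, of "is"] l by simp
    moreover have "(\<Sum>j\<in>UNIV. Dt (V t) (x t) (j # is) * (f (x t) + w t) $ j) =
        (\<Sum>r\<in>UNIV. Dt (V t) (x t) (r # is) * f (x t) $ r) +
        contract11 l (first_mode (P (l + 1) t)) (vec_tensor (w t)) is"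
      using l(3) by (simp add: P_def contract11_def first_mode_def vec_tensor_def distrib_left sum.distrib)
    ultimately show ?thesis
      unfolding P_def by (simp add: algebra_simps)
  qed

  have P2': "((\<lambda>s. tensor_matrix (P 2 s)) has_vector_derivative
      (- (transpose (jacobian f (at (x t))) ** tensor_matrix (P 2 t))
       - tensor_matrix (P 2 t) ** jacobian f (at (x t))
       - tensor_matrix (P 2 t) ** W ** tensor_matrix (P 2 t)
       - tensor_matrix (Rtensor f h G R Q (y t) (x t) (\<lambda>j. P j t) 2)
       + tensor_matrix (contract11 2 (first_mode (P 3 t)) (vec_tensor (w t))))) (at t within {0..T})"
    (is "(_ has_vector_derivative ?D) _") if t: "t \<in> {0..T}" for t
  proof (intro has_vector_derivative_vecI)
    fix i j
    define H where "H = tensor_matrix (P 2 t)"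
    define Jf where "Jf = jacobian f (at (x t))"
    have H: "transpose H = H"
      using hessian_symmetric[OF VC[OF t]] k by (simp add: H_def P_def flip: hessian_def)
    \<comment> \<open>Both mode products with \<open>W P\<^sub>2\<close> equal \<open>P\<^sub>2 W P\<^sub>2\<close>, by the symmetry of \<open>W\<close> and \<open>P\<^sub>2\<close>.\<close>
    have WH: "transpose (W ** H) ** H = H ** W ** H" "H ** (W ** H) = H ** W ** H"
      using W H by (simp_all add: matrix_transpose_mul matrix_mul_assoc)
    have "((\<lambda>s. P 2 s [i, j]) has_real_derivative
        - (transpose Jf ** H + H ** Jf) $ i $ j - (H ** W ** H + H ** W ** H) $ i $ j / 2
        - Rtensor f h G R Q (y t) (x t) (\<lambda>j. P j t) 2 [i, j]
        + contract11 2 (first_mode (P 3 t)) (vec_tensor (w t)) [i, j]) (at t within {0..T})"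
      using P'[OF t, of 2 "[i, j]"] k
      unfolding sum_mode_product_order_2 H_def[symmetric] Jf_def[symmetric] WH by simp
    then show "((\<lambda>s. tensor_matrix (P 2 s) $ i $ j) has_vector_derivative ?D $ i $ j) (at t within {0..T})"
      unfolding H_def[symmetric] Jf_def[symmetric]
      by (simp add: has_real_derivative_iff_has_vector_derivative tensor_matrix_nth)
  qed

  have V0: "V 0 = (\<lambda>\<xi>. 1/2 * sqnorm \<Gamma> (\<xi> - x0))"
    using V_HJB by (auto simp: HJB_def)
  have x_init: "x 0 = x0"
  proof -
    have "sqnorm \<Gamma> z \<ge> 0" for z
      using spd_Gamma by (cases "z = 0") (auto simp: spd_def sqnorm_def intro: less_imp_le)
    then have "is_arg_min (V 0) (\<lambda>_. True) x0"
      by (simp add: is_arg_min_linorder V0 sqnorm_def)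
    with B1_unique[of 0] is_min[of 0] T_pos show ?thesis by auto
  qed
  have P_init: "P j 0 is = (if length is = 2 then \<Gamma> $ (is ! 0) $ (is ! 1) else 0)" if "2 \<le> length is" for j "is"
    unfolding P_def V0 x_init using \<Gamma> that by (rule Dt_centered_quadratic)

  have "observer_system f h G x0 \<Gamma> R Q y T k x P"
    unfolding observer_system_def Let_def
    unfolding w_def[symmetric] W_def[symmetric]
  proof (intro conjI ballI allI impI)
    fix t assume t: "t \<in> {0..T}"
    show "invertible (tensor_matrix (P 2 t))"
      using B2[OF t] by (simp add: P_def hessian_def x_def)
    show "(x has_vector_derivative f (x t) + w t) (at t within {0..T})"
      by (rule x'[OF t])
    show "((\<lambda>s. tensor_matrix (P 2 s)) has_vector_derivative
      (- (transpose (jacobian f (at (x t))) ** tensor_matrix (P 2 t))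
       - tensor_matrix (P 2 t) ** jacobian f (at (x t))
       - tensor_matrix (P 2 t) ** W ** tensor_matrix (P 2 t)
       - tensor_matrix (Rtensor f h G R Q (y t) (x t) (\<lambda>j. P j t) 2)
       + tensor_matrix (contract11 2 (first_mode (P 3 t)) (vec_tensor (w t))))) (at t within {0..T})"
      by (rule P2'[OF t])
  next
    fix t j and "is" :: "'n list" assume t: "t \<in> {0..T}" and "j \<in> {3..k-1}" and len: "length is = j"
    then have j: "2 \<le> j" "j \<le> k" "j \<noteq> 2" by auto
    show "((\<lambda>s. P j s is) has_real_derivative
          (- (\<Sum>i<j. mode_product (P j t) i (jacobian f (at (x t)) + W ** tensor_matrix (P 2 t)) is)
           - Rtensor f h G R Q (y t) (x t) (\<lambda>j. P j t) j is
           + contract11 j (first_mode (P (j+1) t)) (vec_tensor (w t)) is)) (at t within {0..T})"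
      using P'[OF t j(1,2) len] j(3) by (simp add: mode_product_add sum.distrib)
  next
    fix t and "is" :: "'n list" assume t: "t \<in> {0..T}" and l: "length is = k"
    \<comment> \<open>The vanishing of the derivative of order \<open>k + 1\<close> closes the system at order \<open>k\<close>.\<close>
    have "contract11 k (first_mode (P (k+1) t)) (vec_tensor (w t)) is = 0"
      using C[OF t] l by (simp add: contract11_def first_mode_def P_def x_def)
    then show "((\<lambda>s. P k s is) has_real_derivative
          (- (\<Sum>i<k. mode_product (P k t) i (jacobian f (at (x t)) + W ** tensor_matrix (P 2 t)) is)
           - Rtensor f h G R Q (y t) (x t) (\<lambda>j. P j t) k is)) (at t within {0..T})"
      using P'[OF t _ _ l] k by (simp add: mode_product_add sum.distrib)
  next
    show "x 0 = x0" by (rule x_init)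
    show "tensor_matrix (P 2 0) = \<Gamma>"
      by (simp add: vec_eq_iff tensor_matrix_nth P_init)
  next
    fix j and "is" :: "'n list" assume "j \<in> {3..k}" "length is = j"
    then show "P j 0 is = 0" by (simp add: P_init)
  qed
  then show ?thesis unfolding x_def by blast
qed

end
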